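(* Let $A$ be a unital Fréchet $Q$-algebra with an involution, let $B$ be a unital $C^*$-algebra, and let $f:A\to B$ be a dense and full $*$-morphism. Suppose that $f(A)$ is locally normal in $B$. Then $Bsr(A)=Bsr(B)$.
   Context: All algebras are complex. A Fréchet algebra is a (locally convex) Fréchet space with an algebra structure whose multiplication is jointly continuous. A unital topological algebra is a $Q$-algebra if its set of invertible elements is open. Morphisms of unital algebras are algebra homomorphisms preserving the identity; a $*$-morphism also preserves the involution. A morphism $f:A\to B$ is dense if $f(A)$ is dense in $B$, and full if $a$ is invertible in $A$ whenever $f(a)$ is invertible in $B$. Let $C$ be a $*$-algebra which is a dense subalgebra of a $*$-algebra $D$, with common identity $e$. If $D$ is commutative, $C$ is called normal (in $D$) if, on the space $S$ of maximal ideals of $D$, for every pair of disjoint closed subsets $T_1,T_2\subseteq S$ there is $x\in C$ with $x(s)=0$ for $s\in T_1$ and $x(s)=1$ for $s\in T_2$ (where $x(s)$ denotes the Gelfand transform of $x$ at $s$). In general, $C$ is called locally normal in $D$ if for every $x\in C$ there is a commutative Banach $*$-subalgebra $D(x)$ of $D$ containing $e$ and $x$ such that $C(x)=D(x)\cap C$ is a dense normal subalgebra of $D(x)$. For a unital algebra $A$, $Lg_n(A)$ is the set of $(a_1,\dots,a_n)\in A^n$ with $Aa_1+\cdots+Aa_n=A$. The Bass stable rank $Bsr(A)$ is the smallest positive integer $n$ such that for every $(a_1,\dots,a_{n+1})\in Lg_{n+1}(A)$ there is $(c_1,\dots,c_n)\in A^n$ with $(a_1+c_1a_{n+1},\dots,a_n+c_na_{n+1})\in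 Lg_n(A)$, or $\infty$ if no such $n$ exists. *)

theory Defs
  imports "HOL-Analysis.Analysis" "HOL-Library.Extended_Nat"
begin

section \<open>Complex algebras and involutions\<close>

text \<open>Complex scalars are layered on top of the library's real classes; the axiom
  \<open>scaleR_scaleC\<close> says that the real structure is the restriction of the complex one
  (and yields \<open>scaleC 1 x = x\<close>). As everywhere in the library, \<open>1 \<noteq> 0\<close> in unital rings.\<close>

class complex_vector = real_vector +
  fixes scaleC :: "complex \<Rightarrow> 'a \<Rightarrow> 'a"  (infixr "*\<^sub>C" 75)
  assumes scaleC_add_right: "c *\<^sub>C (x + y) = c *\<^sub>C x + c *\<^sub>C y"
    and scaleC_add_left: "(c + d) *\<^sub>C x = c *\<^sub>C x + d *\<^sub>C x"
    and scaleC_scaleC: "c *\<^sub>C d *\<^sub>C x = (c * d) *\<^sub>C x"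
    and scaleR_scaleC: "r *\<^sub>R x = complex_of_real r *\<^sub>C x"

class complex_algebra_1 = complex_vector + real_algebra_1 +
  assumes mult_scaleC_left: "(c *\<^sub>C x) * y = c *\<^sub>C (x * y)"
    and mult_scaleC_right: "x * (c *\<^sub>C y) = c *\<^sub>C (x * y)"

class star_algebra_1 = complex_algebra_1 +
  fixes star :: "'a \<Rightarrow> 'a"
  assumes star_add: "star (x + y) = star x + star y"
    and star_scaleC: "star (c *\<^sub>C x) = cnj c *\<^sub>C star x"
    and star_mult: "star (x * y) = star y * star x"
    and star_star: "star (star x) = x"

class cstar_algebra_1 = star_algebra_1 + real_normed_algebra_1 + banach +
  assumes norm_scaleC: "norm (c *\<^sub>C x) = cmod c * norm x"
    and cstar_identity: "norm (star x * x) = (norm x)\<^sup>2"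


section \<open>Frechet algebras\<close>

definition (in complex_vector) seminorm :: "('a \<Rightarrow> real) \<Rightarrow> bool" where
  "seminorm p \<longleftrightarrow> (\<forall>x y. p (x + y) \<le> p x + p y) \<and> (\<forall>c x. p (c *\<^sub>C x) = cmod c * p x)"

text \<open>A Frechet space is a complete Hausdorff space whose topology is given by a countable
  family of seminorms. Joint continuity of the multiplication is the class
  \<open>topological_semigroup_mult\<close>. The seminorms are not required to be submultiplicative.\<close>

class frechet_algebra_1 = complex_algebra_1 + topological_semigroup_mult +
  assumes frechet: "\<exists>p :: nat \<Rightarrow> 'a \<Rightarrow> real.
      (\<forall>n. seminorm (p n)) \<and>
      (\<forall>x. (\<forall>n. p n x = 0) \<longrightarrow> x = 0) \<and>
      (\<forall>U. open U \<longleftrightarrow> (\<forall>x\<in>U. \<exists>N. \<exists>\<epsilon>>0. {y. \<forall>n\<le>N. p n (y - x) < \<epsilon>} \<subseteq> U)) \<and>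
      (\<forall>X :: nat \<Rightarrow> 'a.
          (\<forall>n. \<forall>\<epsilon>>0. \<exists>M. \<forall>i\<ge>M. \<forall>j\<ge>M. p n (X i - X j) < \<epsilon>) \<longrightarrow>
          (\<exists>l. \<forall>n. (\<lambda>i. p n (X i - l)) \<longlonglongrightarrow> 0))"

definition invertible_elem :: "'a::ring_1 \<Rightarrow> bool" where
  "invertible_elem a \<longleftrightarrow> (\<exists>b. a * b = 1 \<and> b * a = 1)"

definition Q_algebra :: "'a::{ring_1, topological_space} itself \<Rightarrow> bool" where
  "Q_algebra _ \<longleftrightarrow> open {a :: 'a. invertible_elem a}"


section \<open>Morphisms\<close>

text \<open>No continuity is required.\<close>

definition star_morphism :: "('a::star_algebra_1 \<Rightarrow> 'b::star_algebra_1) \<Rightarrow> bool" where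
  "star_morphism f \<longleftrightarrow>
     (\<forall>x y. f (x + y) = f x + f y) \<and>
     (\<forall>c x. f (c *\<^sub>C x) = c *\<^sub>C f x) \<and>
     (\<forall>x y. f (x * y) = f x * f y) \<and>
     f 1 = 1 \<and>
     (\<forall>x. f (star x) = star (f x))"

definition dense_morphism :: "('a \<Rightarrow> 'b::topological_space) \<Rightarrow> bool" where
  "dense_morphism f \<longleftrightarrow> closure (range f) = UNIV"

definition full_morphism :: "('a::ring_1 \<Rightarrow> 'b::ring_1) \<Rightarrow> bool" where
  "full_morphism f \<longleftrightarrow> (\<forall>a. invertible_elem (f a) \<longrightarrow> invertible_elem a)"


section \<open>Maximal ideal spaces and local normality\<close>

definition star_subalgebra :: "'a::star_algebra_1 set \<Rightarrow> bool" where
  "star_subalgebra D \<longleftrightarrow> 1 \<in> D \<and>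
     (\<forall>x\<in>D. \<forall>y\<in>D. x + y \<in> D \<and> x * y \<in> D) \<and>
     (\<forall>c. \<forall>x\<in>D. c *\<^sub>C x \<in> D) \<and>
     (\<forall>x\<in>D. star x \<in> D)"

definition alg_ideal :: "'a::complex_algebra_1 set \<Rightarrow> 'a set \<Rightarrow> bool" where
  "alg_ideal D I \<longleftrightarrow> I \<subseteq> D \<and> 0 \<in> I \<and>
     (\<forall>x\<in>I. \<forall>y\<in>I. x + y \<in> I) \<and>
     (\<forall>d\<in>D. \<forall>x\<in>I. d * x \<in> I \<and> x * d \<in> I)"

definition maximal_ideals :: "'a::complex_algebra_1 set \<Rightarrow> 'a set set" where
  "maximal_ideals D =
     {s. alg_ideal D s \<and> s \<noteq> D \<and> (\<forall>J. alg_ideal D J \<and> s \<subseteq> J \<longrightarrow> J = s \<or> J = D)}"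

text \<open>For a maximal ideal \<open>s\<close> of a commutative unital Banach algebra \<open>D\<close>, the quotient
  \<open>D/s\<close> is the field of complex numbers (Gelfand-Mazur), so the value at \<open>s\<close> of the Gelfand
  transform of \<open>x\<close> is the unique scalar congruent to \<open>x\<close> modulo \<open>s\<close>.\<close>

definition gelfand :: "'a::complex_algebra_1 \<Rightarrow> 'a set \<Rightarrow> complex" where
  "gelfand x s = (THE c. x - c *\<^sub>C 1 \<in> s)"

text \<open>The Gelfand topology: the coarsest one making all Gelfand transforms continuous.\<close>

definition max_ideal_space :: "'a::complex_algebra_1 set \<Rightarrow> 'a set topology" where
  "max_ideal_space D =
     topology_generated_by
       {{s \<in> maximal_ideals D. gelfand x s \<in> U} |x U. x \<in> D \<and> open U}"

definition normal_in :: "'a::complex_algebra_1 set \<Rightarrow> 'a set \<Rightarrow> bool" where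
  "normal_in C D \<longleftrightarrow>
     (\<forall>T1 T2. closedin (max_ideal_space D) T1 \<and> closedin (max_ideal_space D) T2 \<and>
              T1 \<inter> T2 = {} \<longrightarrow>
        (\<exists>x\<in>C. (\<forall>s\<in>T1. gelfand x s = 0) \<and> (\<forall>s\<in>T2. gelfand x s = 1)))"

text \<open>Local normality of \<open>C\<close> in the whole algebra. A Banach *-subalgebra is a
  *-subalgebra that is closed in the norm topology (and hence complete).\<close>

definition locally_normal :: "'a::cstar_algebra_1 set \<Rightarrow> bool" where
  "locally_normal C \<longleftrightarrow>
     star_subalgebra C \<and> closure C = UNIV \<and>
     (\<forall>x\<in>C. \<exists>D. star_subalgebra D \<and> closed D \<and> (\<forall>y\<in>D. \<forall>z\<in>D. y * z = z * y) \<and>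
        x \<in> D \<and> D \<subseteq> closure (D \<inter> C) \<and> normal_in (D \<inter> C) D)"


section \<open>Bass stable rank\<close>

text \<open>An \<open>n\<close>-tuple is a sequence \<open>a\<close> of which only the entries \<open>a 0, \<dots>, a (n - 1)\<close> are
  looked at; thus the last entry of an \<open>(n + 1)\<close>-tuple is \<open>a n\<close>.\<close>

definition Lg :: "nat \<Rightarrow> (nat \<Rightarrow> 'a::ring_1) set" where
  "Lg n = {a. {(\<Sum>i<n. b i * a i) |b. True} = UNIV}"

definition Bsr_condition :: "'a::ring_1 itself \<Rightarrow> nat \<Rightarrow> bool" where
  "Bsr_condition _ n \<longleftrightarrow>
     (\<forall>a :: nat \<Rightarrow> 'a. a \<in> Lg (n + 1) \<longrightarrow> (\<exists>c. (\<lambda>i. a i + c i * a n) \<in> Lg n))"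

definition Bsr :: "'a::ring_1 itself \<Rightarrow> enat" where
  "Bsr T = (if \<exists>n\<ge>1. Bsr_condition T n
            then enat (LEAST n. n \<ge> 1 \<and> Bsr_condition T n) else \<infinity>)"

end

theory Submission
  imports Defs
begin

text \<open>Density and fullness give: \<open>a\<close> is unimodular iff \<open>f a\<close> is, so only the passage of the
  stable rank condition from \<open>A\<close> to \<open>B\<close> is hard, because the coefficients \<open>c\<^sub>i\<close> found for an
  approximation of a tuple cannot be bounded. Normalise \<open>(a\<^sub>1,\<dots>,a\<^sub>n,\<alpha>)\<close> by
  \<open>\<Sum> b\<^sub>i a\<^sub>i + \<alpha> = 1\<close>, let \<open>\<alpha>' \<in> f(A)\<close> be close to \<open>\<alpha>\<close>, and put \<open>h = \<alpha>\<^sup>*\<alpha>\<close>,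
  \<open>h' = \<alpha>'\<^sup>*\<alpha>'\<close>. Local normality at \<open>h'\<close> yields \<open>y \<in> f(A)\<close> that vanishes where \<open>h'\<close> is small
  and is \<open>1\<close> where it is not, and a functional calculus element \<open>g\<close> of controlled norm with
  \<open>y g h' = y\<close>. Then \<open>(a'\<^sub>1,\<dots>,a'\<^sub>n,y)\<close> is unimodular for \<open>a'\<^sub>i \<in> f(A)\<close> close to \<open>a\<^sub>i\<close>, and
  \<open>u = 1 + g(h - h')\<close> is invertible, close to \<open>1\<close>, with \<open>y u = y g h \<in> B\<alpha>\<close>. Reducing
  \<open>(a'\<^sub>i, y)\<close> in \<open>A\<close> and multiplying by \<open>u\<close> on the right thus reduces a tuple
  \<open>(a'\<^sub>i u, \<alpha>)\<close>, and modulo \<open>\<alpha>\<close> the entries \<open>a'\<^sub>i u\<close> arise from the \<open>a\<^sub>i\<close> by an invertible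
  matrix close to the identity.\<close>

section \<open>Complex scalars\<close>

lemma scaleC_one [simp]: "1 *\<^sub>C (x::'a::complex_vector) = x"
  using scaleR_scaleC[of 1 x] by simp

lemma scaleC_zero_left [simp]: "0 *\<^sub>C (x::'a::complex_vector) = 0"
  using scaleC_add_left[of 0 0 x] by simp

lemma scaleC_zero_right [simp]: "c *\<^sub>C (0::'a::complex_vector) = 0"
  using scaleC_add_right[of c 0 0] by simp

lemma scaleC_minus_left: "(- c) *\<^sub>C (x::'a::complex_vector) = - (c *\<^sub>C x)"
  using scaleC_add_left[of c "- c" x] by (simp add: eq_neg_iff_add_eq_0 add.commute)

lemma scaleC_minus_right: "c *\<^sub>C (- x::'a::complex_vector) = - (c *\<^sub>C x)"
  using scaleC_add_right[of c x "- x"] by (simp add: eq_neg_iff_add_eq_0 add.commute)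

lemma scaleC_diff_left: "(c - d) *\<^sub>C (x::'a::complex_vector) = c *\<^sub>C x - d *\<^sub>C x"
  using scaleC_add_left[of c "- d" x] by (simp add: scaleC_minus_left)

lemma scaleC_diff_right: "c *\<^sub>C (x - y::'a::complex_vector) = c *\<^sub>C x - c *\<^sub>C y"
  using scaleC_add_right[of c x "- y"] by (simp add: scaleC_minus_right)

lemma scaleC_power: "(c *\<^sub>C (x::'a::complex_algebra_1)) ^ n = (c ^ n) *\<^sub>C (x ^ n)"
  by (induction n) (simp_all add: mult_scaleC_left mult_scaleC_right scaleC_scaleC mult.commute)

lemma scaleC_half_double: "(1/2) *\<^sub>C (x + x) = (x::'a::complex_vector)"
  by (simp add: scaleC_add_right flip: scaleC_add_left)

lemmas scaleC_simps = scaleC_scaleC mult_scaleC_left mult_scaleC_right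
  scaleC_add_left scaleC_add_right scaleC_diff_left scaleC_diff_right
  scaleC_minus_left scaleC_minus_right

section \<open>The spectral radius in a seminormed commutative algebra\<close>

locale comm_subalgebra =
  fixes D :: "'b::complex_algebra_1 set"
  assumes one_mem [simp, intro]: "1 \<in> D"
    and add_mem [simp, intro]: "x \<in> D \<Longrightarrow> y \<in> D \<Longrightarrow> x + y \<in> D"
    and mult_mem [simp, intro]: "x \<in> D \<Longrightarrow> y \<in> D \<Longrightarrow> x * y \<in> D"
    and scaleC_mem [simp, intro]: "x \<in> D \<Longrightarrow> c *\<^sub>C x \<in> D"
    and commute: "x \<in> D \<Longrightarrow> y \<in> D \<Longrightarrow> x * y = y * x"
begin

lemma minus_mem [simp, intro]: "x \<in> D \<Longrightarrow> - x \<in> D"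
  using scaleC_mem[of x "-1"] by (simp add: scaleC_minus_left)

lemma diff_mem [simp, intro]: "x \<in> D \<Longrightarrow> y \<in> D \<Longrightarrow> x - y \<in> D"
  using add_mem[of x "- y"] by simp

lemma zero_mem [simp, intro]: "0 \<in> D"
  using diff_mem[OF one_mem one_mem] by simp

lemma power_mem [simp, intro]: "x \<in> D \<Longrightarrow> x ^ n \<in> D"
  by (induction n) auto

end

text \<open>The seminorm may have a kernel, so one spectral radius argument serves both the norm of
  a commutative C*-subalgebra and the quotient seminorm modulo a maximal ideal.\<close>

locale seminormed_subalgebra = comm_subalgebra +
  fixes q :: "'b::complex_algebra_1 \<Rightarrow> real"
  assumes q_add: "x \<in> D \<Longrightarrow> y \<in> D \<Longrightarrow> q (x + y) \<le> q x + q y"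
    and q_scaleC: "x \<in> D \<Longrightarrow> q (c *\<^sub>C x) = cmod c * q x"
    and q_mult: "x \<in> D \<Longrightarrow> y \<in> D \<Longrightarrow> q (x * y) \<le> q x * q y"
begin

lemma q_zero [simp]: "q 0 = 0"
  using q_scaleC[of 0 0] by simp

lemma q_minus: "x \<in> D \<Longrightarrow> q (- x) = q x"
  using q_scaleC[of x "-1"] by (simp add: scaleC_minus_left)

lemma q_diff: "x \<in> D \<Longrightarrow> y \<in> D \<Longrightarrow> q (x - y) \<le> q x + q y"
  using q_add[of x "- y"] by (simp add: q_minus)

lemma q_nonneg: assumes "x \<in> D" shows "0 \<le> q x"
  using q_diff[OF assms assms] by simp

lemma q_mult_null:
  assumes "x \<in> D" "y \<in> D" "q x = 0 \<or> q y = 0" shows "q (x * y) = 0"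
  using q_mult[OF assms(1,2)] q_nonneg[of "x * y"] assms by auto

text \<open>An inverse in the quotient of \<open>D\<close> by the null space of
  \<open>q\<close>.\<close>

definition inverts :: "'b \<Rightarrow> 'b \<Rightarrow> bool" where
  "inverts u v \<longleftrightarrow> u \<in> D \<and> v \<in> D \<and> q (u * v - 1) = 0"

text \<open>The resolvent identity \<open>v - v' = v * (u' - u) * v'\<close> holds up to terms with
  a null factor, on which \<open>q\<close> vanishes.\<close>

lemma inverts_diff:
  assumes "inverts u v" "inverts u' v'"
  shows "q (v - v') \<le> q (u' - u) * q v * q v'"
proof -
  have mem: "u \<in> D" "v \<in> D" "u' \<in> D" "v' \<in> D"
    and null: "q (u * v - 1) = 0" "q (u' * v' - 1) = 0"
    using assms by (auto simp: inverts_def)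
  have "v - v' = v * ((u' - u) * v') + ((u * v - 1) * v' - v * (u' * v' - 1))"
    using commute[of u v] mem by (simp add: algebra_simps)
  also have "q \<dots> \<le> q (v * ((u' - u) * v')) + (q ((u * v - 1) * v') + q (v * (u' * v' - 1)))"
    using mem by (intro order_trans[OF q_add] add_left_mono q_diff) auto
  finally have "q (v - v') \<le> q (v * ((u' - u) * v')) + (q ((u * v - 1) * v') + q (v * (u' * v' - 1)))" .
  moreover have "q ((u * v - 1) * v') = 0" "q (v * (u' * v' - 1)) = 0"
    using mem null by (auto intro!: q_mult_null)
  moreover have "q (v * ((u' - u) * v')) \<le> q v * (q (u' - u) * q v')"
    using mem by (intro order_trans[OF q_mult] mult_left_mono q_mult q_nonneg) auto
  ultimately show ?thesis by (simp add: algebra_simps)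
qed

text \<open>Partial fractions: \<open>2/(1 - w^2) = 1/(1 - w) + 1/(1 + w)\<close>. This is the
  doubling step for the averages over roots of unity.\<close>

lemma inverts_average:
  assumes "w \<in> D" "inverts (1 - w) v" "inverts (1 + w) v'"
  shows "inverts (1 - w ^ 2) ((1/2) *\<^sub>C (v + v'))"
proof -
  have mem: "v \<in> D" "v' \<in> D" using assms by (auto simp: inverts_def)
  have "(1 - w ^ 2) * ((1/2) *\<^sub>C (v + v')) - 1 =
        (1/2) *\<^sub>C ((1 - w ^ 2) * (v + v') - (1 + 1))"
    by (simp only: mult_scaleC_right scaleC_diff_right scaleC_half_double)
  also have "(1 - w ^ 2) * (v + v') - (1 + 1) =
      (1 + w) * ((1 - w) * v - 1) + (1 - w) * ((1 + w) * v' - 1)"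
    by (simp add: algebra_simps power2_eq_square)
  finally have eq: "(1 - w ^ 2) * ((1/2) *\<^sub>C (v + v')) - 1 =
      (1/2) *\<^sub>C ((1 + w) * ((1 - w) * v - 1) + (1 - w) * ((1 + w) * v' - 1))" .
  have "q ((1 + w) * ((1 - w) * v - 1) + (1 - w) * ((1 + w) * v' - 1)) \<le> 0"
    using q_add[of "(1 + w) * ((1 - w) * v - 1)" "(1 - w) * ((1 + w) * v' - 1)"]
      q_mult_null[of "1 + w" "(1 - w) * v - 1"] q_mult_null[of "1 - w" "(1 + w) * v' - 1"]
      assms mem by (simp add: inverts_def)
  moreover have "(1 + w) * ((1 - w) * v - 1) + (1 - w) * ((1 + w) * v' - 1) \<in> D"
    using assms mem by auto
  ultimately have "q ((1 - w ^ 2) * ((1/2) *\<^sub>C (v + v')) - 1) = 0"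
    unfolding eq using q_scaleC q_nonneg by (metis mult_zero_right order_antisym)
  then show ?thesis using assms mem by (auto simp: inverts_def)
qed

lemma q_half_sum:
  assumes "a \<in> D" "b \<in> D" "q a \<le> K" "q b \<le> K"
  shows "q ((1/2) *\<^sub>C (a + b)) \<le> K"
  using q_add[of a b] assms by (simp add: q_scaleC)

text \<open>Here \<open>R\<close> is an arbitrary choice of inverses, so compactness of the disc is
  combined with the resolvent identity. Near an accumulation point \<open>l\<close> of parameters
  with ever larger resolvents that identity gives
  \<open>q (R \<mu>) \<le> K + q (R \<mu>) / 2\<close>, hence the bound
  \<open>2 * K\<close>.\<close>

lemma resolvent_bounded:
  assumes x: "x \<in> D" and R: "\<And>\<mu>. cmod \<mu> \<le> \<rho> \<Longrightarrow> inverts (1 - \<mu> *\<^sub>C x) (R \<mu>)"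
  shows "\<exists>M>0. \<forall>\<mu>. cmod \<mu> \<le> \<rho> \<longrightarrow> q (R \<mu>) \<le> M"
proof (rule ccontr)
  assume contr: "\<not> ?thesis"
  have "\<exists>\<mu>. cmod \<mu> \<le> \<rho> \<and> q (R \<mu>) > real n + 1" for n :: nat
  proof (rule ccontr)
    assume "\<not> ?thesis"
    then have "\<forall>\<mu>. cmod \<mu> \<le> \<rho> \<longrightarrow> q (R \<mu>) \<le> real n + 1" by force
    then show False using contr by (auto dest!: spec[of _ "real n + 1"])
  qed
  then obtain z where z: "\<And>n. cmod (z n) \<le> \<rho>" "\<And>n::nat. q (R (z n)) > real n + 1"
    by metis
  have "compact (cball 0 \<rho> :: complex set)" by simp
  moreover have "\<forall>n. z n \<in> cball 0 \<rho>" using z(1) by simp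
  ultimately obtain l k where l: "l \<in> cball 0 \<rho>" and k: "strict_mono (k :: nat \<Rightarrow> nat)"
    and lim: "(z \<circ> k) \<longlonglongrightarrow> l"
    unfolding compact_def by metis
  have Rl: "inverts (1 - l *\<^sub>C x) (R l)" using l R by simp
  define K where "K = q (R l)"
  have "(\<lambda>n. cmod (z (k n) - l) * q x * K) \<longlonglongrightarrow> cmod (l - l) * q x * K"
    using lim by (intro tendsto_intros) (simp add: o_def)
  then have "\<forall>\<^sub>F n in sequentially. cmod (z (k n) - l) * q x * K < 1/2"
    by (rule order_tendstoD) simp
  moreover have "\<forall>\<^sub>F n in sequentially. real n > 2 * K"
    using filterlim_real_sequentially by (rule eventually_compose_filterlim[OF eventually_gt_at_top])
  ultimately have "\<forall>\<^sub>F n in sequentially. False"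
  proof eventually_elim
    case (elim n)
    let ?\<mu> = "z (k n)"
    have mem: "R ?\<mu> \<in> D" "R l \<in> D" using R[OF z(1)] Rl by (auto simp: inverts_def)
    have "q (R ?\<mu>) \<le> q (R ?\<mu> - R l) + K"
      unfolding K_def using q_add[of "R ?\<mu> - R l" "R l"] mem by simp
    also have "q (R ?\<mu> - R l) \<le> q ((1 - l *\<^sub>C x) - (1 - ?\<mu> *\<^sub>C x)) * q (R ?\<mu>) * K"
      unfolding K_def by (rule inverts_diff[OF R[OF z(1)] Rl])
    also have "(1 - l *\<^sub>C x) - (1 - ?\<mu> *\<^sub>C x) = (?\<mu> - l) *\<^sub>C x"
      by (simp add: scaleC_diff_left)
    also have "q \<dots> * q (R ?\<mu>) * K = (cmod (?\<mu> - l) * q x * K) * q (R ?\<mu>)"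
      using x by (simp add: q_scaleC)
    also have "\<dots> \<le> (1/2) * q (R ?\<mu>)"
      using elim mem by (intro mult_right_mono q_nonneg) auto
    finally have "q (R ?\<mu>) \<le> 2 * K" by simp
    moreover have "q (R ?\<mu>) > real n + 1"
      using z(2)[of "k n"] seq_suble[OF k, of n] by linarith
    ultimately show False using elim by simp
  qed
  then show False by simp
qed

text \<open>With \<open>N = 2\<^sup>m\<close>, the function \<open>G\<close> is the mean of the resolvents \<open>R (\<zeta>\<mu>)\<close> over the \<open>N\<close>-th
  roots of unity \<open>\<zeta>\<close>; a mean inherits the bound and the Lipschitz constant of \<open>R\<close>.\<close>

lemma averaged_resolvent:
  assumes x: "x \<in> D" and R: "\<And>\<mu>. cmod \<mu> \<le> \<rho> \<Longrightarrow> inverts (1 - \<mu> *\<^sub>C x) (R \<mu>)"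
    and M: "\<And>\<mu>. cmod \<mu> \<le> \<rho> \<Longrightarrow> q (R \<mu>) \<le> M"
  shows "\<exists>G. \<forall>\<mu>. cmod \<mu> \<le> \<rho> \<longrightarrow>
      inverts (1 - \<mu> ^ 2 ^ m *\<^sub>C x ^ 2 ^ m) (G \<mu>) \<and> q (G \<mu>) \<le> M \<and>
      (\<forall>s\<in>{0..1}. \<forall>t\<in>{0..1}. q (G (of_real s * \<mu>) - G (of_real t * \<mu>)) \<le> \<rho> * q x * M * M * \<bar>s - t\<bar>)"
proof (induction m)
  case 0
  have "q (R (of_real s * \<mu>) - R (of_real t * \<mu>)) \<le> \<rho> * q x * M * M * \<bar>s - t\<bar>"
    if mu: "cmod \<mu> \<le> \<rho>" and st: "s \<in> {0..1}" "t \<in> {0..1}" for s t \<mu>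
  proof -
    have le: "cmod (of_real s * \<mu>) \<le> \<rho>" "cmod (of_real t * \<mu>) \<le> \<rho>"
      using mu st mult_left_le_one_le[of "cmod \<mu>" s] mult_left_le_one_le[of "cmod \<mu>" t]
      by (auto simp: norm_mult)
    have \<rho>0: "0 \<le> \<rho>" using mu norm_ge_zero order_trans by blast
    have nn: "0 \<le> q (R (of_real s * \<mu>))" "0 \<le> q (R (of_real t * \<mu>))"
      using R[OF le(1)] R[OF le(2)] by (auto simp: inverts_def q_nonneg)
    have "q (R (of_real s * \<mu>) - R (of_real t * \<mu>)) \<le>
        q ((1 - (of_real t * \<mu>) *\<^sub>C x) - (1 - (of_real s * \<mu>) *\<^sub>C x))
         * q (R (of_real s * \<mu>)) * q (R (of_real t * \<mu>))"
      by (rule inverts_diff[OF R[OF le(1)] R[OF le(2)]])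
    also have "(1 - (of_real t * \<mu>) *\<^sub>C x) - (1 - (of_real s * \<mu>) *\<^sub>C x) = (of_real (s - t) * \<mu>) *\<^sub>C x"
      by (simp add: left_diff_distrib scaleC_diff_left)
    also have "q \<dots> = \<bar>s - t\<bar> * cmod \<mu> * q x"
      using x by (simp add: q_scaleC norm_mult del: of_real_diff)
    also have "\<dots> * q (R (of_real s * \<mu>)) * q (R (of_real t * \<mu>)) \<le> \<bar>s - t\<bar> * \<rho> * q x * M * M"
    proof -
      have "\<bar>s - t\<bar> * cmod \<mu> * q x \<le> \<bar>s - t\<bar> * \<rho> * q x"
        using mu x \<rho>0 by (intro mult_mono) (auto simp: q_nonneg)
      moreover have "0 \<le> \<bar>s - t\<bar> * cmod \<mu> * q x" using x by (simp add: q_nonneg)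
      ultimately show ?thesis
        using M[OF le(1)] M[OF le(2)] nn \<rho>0 x
        by (meson abs_ge_zero mult_mono mult_nonneg_nonneg order_trans q_nonneg)
    qed
    finally show ?thesis by (simp add: algebra_simps)
  qed
  then show ?case using R M by (intro exI[of _ R]) auto
next
  case (Suc m)
  then obtain G where G: "\<And>\<mu>. cmod \<mu> \<le> \<rho> \<Longrightarrow> inverts (1 - \<mu> ^ 2 ^ m *\<^sub>C x ^ 2 ^ m) (G \<mu>)"
    "\<And>\<mu>. cmod \<mu> \<le> \<rho> \<Longrightarrow> q (G \<mu>) \<le> M"
    "\<And>\<mu> s t. cmod \<mu> \<le> \<rho> \<Longrightarrow> s \<in> {0..1} \<Longrightarrow> t \<in> {0..1} \<Longrightarrow>
       q (G (of_real s * \<mu>) - G (of_real t * \<mu>)) \<le> \<rho> * q x * M * M * \<bar>s - t\<bar>"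
    by blast
  \<comment> \<open>Since the power of \<zeta> with exponent \<open>2 ^ m\<close> is -1, passing
    from \<mu> to \<open>\<zeta> * \<mu>\<close> turns \<open>1 - ?w\<close> into
    \<open>1 + ?w\<close>; these are the two factors of \<open>1 - ?w ^ 2\<close>.\<close>
  define \<zeta> where "\<zeta> = cis (pi / 2 ^ m)"
  have z1: "cmod (\<zeta> * \<mu>) = cmod \<mu>" for \<mu> by (simp add: \<zeta>_def norm_mult)
  have z2: "\<zeta> ^ 2 ^ m = -1"
    unfolding \<zeta>_def Complex.DeMoivre by simp
  have Gmem: "G \<mu> \<in> D" if "cmod \<mu> \<le> \<rho>" for \<mu> using G(1)[OF that] by (simp add: inverts_def)
  define H where "H \<mu> = (1/2) *\<^sub>C (G \<mu> + G (\<zeta> * \<mu>))" for \<mu>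
  have "inverts (1 - \<mu> ^ 2 ^ Suc m *\<^sub>C x ^ 2 ^ Suc m) (H \<mu>) \<and> q (H \<mu>) \<le> M \<and>
      (\<forall>s\<in>{0..1}. \<forall>t\<in>{0..1}. q (H (of_real s * \<mu>) - H (of_real t * \<mu>)) \<le> \<rho> * q x * M * M * \<bar>s - t\<bar>)"
    if mu: "cmod \<mu> \<le> \<rho>" for \<mu>
  proof (intro conjI ballI)
    have mu': "cmod (\<zeta> * \<mu>) \<le> \<rho>" using mu z1 by simp
    let ?w = "\<mu> ^ 2 ^ m *\<^sub>C x ^ 2 ^ m"
    have "inverts (1 - ?w ^ 2) (H \<mu>)"
      unfolding H_def
    proof (rule inverts_average)
      show "inverts (1 + ?w) (G (\<zeta> * \<mu>))"
        using G(1)[OF mu'] by (simp add: power_mult_distrib z2 scaleC_minus_left)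
    qed (use G(1)[OF mu] x in auto)
    moreover have "?w ^ 2 = \<mu> ^ 2 ^ Suc m *\<^sub>C x ^ 2 ^ Suc m"
      by (simp add: scaleC_power mult.commute flip: power_mult)
    ultimately show "inverts (1 - \<mu> ^ 2 ^ Suc m *\<^sub>C x ^ 2 ^ Suc m) (H \<mu>)" by simp
    show "q (H \<mu>) \<le> M"
      unfolding H_def using G(2)[OF mu] G(2)[OF mu'] Gmem mu mu' by (intro q_half_sum) auto
    fix s t :: real assume st: "s \<in> {0..1}" "t \<in> {0..1}"
    have le: "cmod (of_real r * \<mu>) \<le> \<rho>" "cmod (of_real r * (\<zeta> * \<mu>)) \<le> \<rho>"
      if "r \<in> {0..1}" for r
      using mu that mult_left_le_one_le[of "cmod \<mu>" r] z1[of \<mu>] by (auto simp: norm_mult)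
    have "H (of_real s * \<mu>) - H (of_real t * \<mu>) = (1/2) *\<^sub>C
        ((G (of_real s * \<mu>) - G (of_real t * \<mu>)) +
         (G (of_real s * (\<zeta> * \<mu>)) - G (of_real t * (\<zeta> * \<mu>))))"
      unfolding H_def by (simp add: algebra_simps scaleC_simps)
    also have "q \<dots> \<le> \<rho> * q x * M * M * \<bar>s - t\<bar>"
      using G(3)[OF mu st] G(3)[OF mu' st] Gmem le st by (intro q_half_sum) auto
    finally show "q (H (of_real s * \<mu>) - H (of_real t * \<mu>)) \<le> \<rho> * q x * M * M * \<bar>s - t\<bar>" .
  qed
  then show ?case by blast
qed

section \<open>Small powers, resolvents near one, and the spectral radius bound\<close>

lemma q_power_pow2:
  assumes "x \<in> D" "q (x ^ 2 ^ m) \<le> 1/2" "\<eta> > 0"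
  shows "\<exists>m'. q (x ^ 2 ^ m') \<le> \<eta>"
proof -
  have "q (x ^ 2 ^ (m + j)) \<le> (1/2) ^ Suc j" for j
  proof (induction j)
    case (Suc j)
    have "x ^ 2 ^ (m + Suc j) = x ^ 2 ^ (m + j) * x ^ 2 ^ (m + j)"
      by (simp flip: power_add) (simp add: mult_2)
    then have "q (x ^ 2 ^ (m + Suc j)) \<le> q (x ^ 2 ^ (m + j)) * q (x ^ 2 ^ (m + j))"
      using q_mult assms(1) by simp
    also have "\<dots> \<le> (1/2) ^ Suc j * (1/2) ^ Suc j"
      using Suc assms(1) by (intro mult_mono q_nonneg) auto
    also have "\<dots> \<le> (1/2) ^ Suc (Suc j)"
      by (simp add: power_le_one divide_simps)
    finally show ?case .
  qed (use assms in auto)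
  note decay = this
  obtain j where j: "(1/2::real) ^ j < \<eta>"
    using assms(3) real_arch_pow_inv[of \<eta> "1/2"] by auto
  have "(1/2::real) ^ Suc j \<le> (1/2) ^ j" by simp
  then show ?thesis using decay[of j] j by (intro exI[of _ "m + j"]) linarith
qed

text \<open>Up to a null term \<open>u = (v - 1) - u * (v - 1)\<close>, so
  \<open>q u \<le> 1/4 + q u / 4\<close>, and the last summand is absorbed on the left.\<close>

lemma small_if_inverse_near_one:
  assumes "inverts (1 - u) v" "u \<in> D" "q (v - 1) \<le> 1/4"
  shows "q u \<le> 1/2"
proof -
  have v: "v \<in> D" using assms by (simp add: inverts_def)
  have "u = (v - 1) - (u * (v - 1) + ((1 - u) * v - 1))"
    by (simp add: algebra_simps)
  then have "q u \<le> q (v - 1) + (q (u * (v - 1)) + q ((1 - u) * v - 1))"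
    using q_diff[of "v - 1" "u * (v - 1) + ((1 - u) * v - 1)"]
      q_add[of "u * (v - 1)" "(1 - u) * v - 1"] v assms(2) by simp
  also have "q ((1 - u) * v - 1) = 0" using assms by (simp add: inverts_def)
  also have "q (u * (v - 1)) \<le> q u * (1/4)"
    using v assms by (intro order_trans[OF q_mult] mult_left_mono q_nonneg) auto
  finally show ?thesis using assms(3) by simp
qed

lemma inverse_near_one_if_small:
  assumes "inverts (1 - u) v" "u \<in> D"
  shows "q (v - 1) \<le> q u * q v"
proof -
  have v: "v \<in> D" using assms by (simp add: inverts_def)
  have eq: "v - 1 = u * v + ((1 - u) * v - 1)"
    by (simp add: algebra_simps)
  have "q (u * v + ((1 - u) * v - 1)) \<le> q (u * v) + q ((1 - u) * v - 1)"
    using v assms(2) by (intro q_add) auto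
  then have "q (v - 1) \<le> q (u * v) + q ((1 - u) * v - 1)" unfolding eq[symmetric] .
  then show ?thesis using q_mult[of u v] assms v by (simp add: inverts_def)
qed

text \<open>A continuity method takes the place of complex function theory. The parameter of
  \<open>X t\<close> runs from 0 to 1 in \<open>N\<close> steps. If some power of \<open>X s\<close>
  is small, the averaged resolvent \<open>g s\<close> is near 1. Its Lipschitz constant
  \<open>K\<close> does not depend on \<open>m\<close>, so \<open>g t\<close> is still near 1 one
  step further, which forces the same power of \<open>X t\<close> to be small.\<close>

theorem spectral_radius:
  assumes x: "x \<in> D" and r: "r > 0"
    and inv: "\<And>z. cmod z \<ge> r \<Longrightarrow> \<exists>y\<in>D. q ((x - z *\<^sub>C 1) * y - 1) = 0"
  shows "\<exists>m. q (x ^ 2 ^ m) < r ^ 2 ^ m"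
proof -
  define \<rho> where "\<rho> = 1 / r"
  have \<rho>: "\<rho> > 0" using r by (simp add: \<rho>_def)
  \<comment> \<open>The substitution \<open>z = 1 / \<mu>\<close> carries the region where inverses
    are given to the punctured disc of radius \<rho>; at its centre the inverse is 1.\<close>
  have "\<exists>y. inverts (1 - \<mu> *\<^sub>C x) y" if mu: "cmod \<mu> \<le> \<rho>" for \<mu>
  proof (cases "\<mu> = 0")
    case True
    then show ?thesis by (auto simp: inverts_def intro!: exI[of _ 1])
  next
    case False
    then have "cmod (1 / \<mu>) \<ge> r" using mu r by (simp add: \<rho>_def norm_divide field_simps)
    then obtain y where y: "y \<in> D" "q ((x - (1 / \<mu>) *\<^sub>C 1) * y - 1) = 0" using inv by blast
    have "(1 - \<mu> *\<^sub>C x) * ((- 1 / \<mu>) *\<^sub>C y) = (x - (1 / \<mu>) *\<^sub>C 1) * y"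
      using False by (simp add: algebra_simps scaleC_simps)
    then show ?thesis using x y by (auto simp: inverts_def intro!: exI[of _ "(- 1 / \<mu>) *\<^sub>C y"])
  qed
  then obtain R where R: "\<And>\<mu>. cmod \<mu> \<le> \<rho> \<Longrightarrow> inverts (1 - \<mu> *\<^sub>C x) (R \<mu>)" by metis
  obtain M where M: "M > 0" "\<And>\<mu>. cmod \<mu> \<le> \<rho> \<Longrightarrow> q (R \<mu>) \<le> M"
    using resolvent_bounded[OF x R] by blast
  define K where "K = \<rho> * q x * M * M"
  have K: "K \<ge> 0" using x \<rho> M by (simp add: K_def q_nonneg)
  \<comment> \<open>One step of length \<open>1 / N\<close> moves the averaged resolvent by at most
    \<open>K / N \<le> 1/8\<close>, whatever \<open>m\<close> is.\<close>
  obtain N :: nat where N: "real N > 8 * K" "N > 0"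
    using reals_Archimedean2[of "8 * K"] K by (metis gr0I mult_nonneg_nonneg not_le of_nat_0 zero_le_numeral)
  define X where "X t = of_real (t * \<rho>) *\<^sub>C x" for t :: real
  have Xmem: "X t \<in> D" for t using x by (simp add: X_def)
  have "\<exists>m. q (X (real j / N) ^ 2 ^ m) \<le> 1/2" if "j \<le> N" for j
    using that
  proof (induction j)
    case 0
    then show ?case by (intro exI[of _ 0]) (simp add: X_def)
  next
    case (Suc j)
    then obtain m0 where "q (X (real j / N) ^ 2 ^ m0) \<le> 1/2" by auto
    \<comment> \<open>Below \<open>1 / (8 * M)\<close> the power puts \<open>g s\<close> within 1/8
      of 1, because \<open>q (g s) \<le> M\<close>. With the 1/8 lost in the step this meets the
      threshold 1/4 of \<open>small_if_inverse_near_one\<close>.\<close>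
    from q_power_pow2[OF Xmem this, of "1 / (8 * M)"] M(1)
    obtain m where m: "q (X (real j / N) ^ 2 ^ m) \<le> 1 / (8 * M)" by auto
    obtain G where G: "\<And>\<mu>. cmod \<mu> \<le> \<rho> \<Longrightarrow> inverts (1 - \<mu> ^ 2 ^ m *\<^sub>C x ^ 2 ^ m) (G \<mu>)"
      "\<And>\<mu>. cmod \<mu> \<le> \<rho> \<Longrightarrow> q (G \<mu>) \<le> M"
      "\<And>\<mu> s t. cmod \<mu> \<le> \<rho> \<Longrightarrow> s \<in> {0..1} \<Longrightarrow> t \<in> {0..1} \<Longrightarrow>
         q (G (of_real s * \<mu>) - G (of_real t * \<mu>)) \<le> K * \<bar>s - t\<bar>"
      using averaged_resolvent[OF x, of \<rho> R M m] R M(2) unfolding K_def by blast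
    define g where "g t = G (of_real t * of_real \<rho>)" for t
    have g: "inverts (1 - X t ^ 2 ^ m) (g t)" "q (g t) \<le> M" if "t \<in> {0..1}" for t
    proof -
      have "cmod (of_real t * of_real \<rho>) \<le> \<rho>"
        using that \<rho> mult_left_le_one_le[of \<rho> t] by (auto simp: norm_mult)
      then show "inverts (1 - X t ^ 2 ^ m) (g t)" "q (g t) \<le> M"
        using G(1,2) unfolding g_def X_def scaleC_power by auto
    qed
    define s t where "s = real j / N" and "t = real (Suc j) / N"
    have st: "s \<in> {0..1}" "t \<in> {0..1}" "\<bar>t - s\<bar> = 1 / N"
      using Suc.prems N(2) by (auto simp: s_def t_def field_simps)
    have mem: "g s \<in> D" "g t \<in> D" using g(1) st by (auto simp: inverts_def)
    have "q (g s - 1) \<le> q (X s ^ 2 ^ m) * q (g s)"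
      using g(1)[OF st(1)] Xmem by (intro inverse_near_one_if_small) auto
    also have "\<dots> \<le> 1 / (8 * M) * M"
      using m M(1) g(2)[OF st(1)] mem unfolding s_def[symmetric] by (intro mult_mono q_nonneg) auto
    finally have 1: "q (g s - 1) \<le> 1/8" using M(1) by simp
    have "q (g t - g s) \<le> K * (1 / N)"
      using G(3)[of "of_real \<rho>" t s] st \<rho> unfolding g_def by simp
    also have "\<dots> \<le> 1/8" using N by (simp add: field_simps)
    finally have "q (g t - 1) \<le> 1/4"
      using 1 q_add[of "g t - g s" "g s - 1"] mem by simp
    then have "q (X t ^ 2 ^ m) \<le> 1/2"
      using g(1)[OF st(2)] Xmem by (intro small_if_inverse_near_one) auto
    then show ?case unfolding t_def by blast
  qed
  from this[of N] obtain m where "q (X 1 ^ 2 ^ m) \<le> 1/2" using N by auto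
  then have "\<rho> ^ 2 ^ m * q (x ^ 2 ^ m) \<le> 1/2"
    unfolding X_def scaleC_power using x \<rho> by (simp add: q_scaleC norm_power)
  then have "q (x ^ 2 ^ m) \<le> 1/2 * r ^ 2 ^ m"
    using r by (simp add: \<rho>_def power_divide field_simps)
  also have "\<dots> < r ^ 2 ^ m" using r by simp
  finally show ?thesis by blast
qed

end


section \<open>Gelfand theory of commutative C*-subalgebras\<close>

lemma mult_infdist_ge:
  assumes "s \<noteq> {}" "0 \<le> c" "\<And>z. z \<in> s \<Longrightarrow> k \<le> c * dist x z"
  shows "k \<le> c * infdist x s"
proof (cases "c = 0")
  case True
  then show ?thesis using assms by auto
next
  case False
  then have "k / c \<le> (INF z\<in>s. dist x z)"
    using assms by (intro cINF_greatest) (auto simp: field_simps)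
  then show ?thesis using False assms by (simp add: infdist_notempty field_simps)
qed

text \<open>The partial sums of the geometric series lie in \<open>D\<close> and \<open>D\<close> is
  closed, so the inverse stays in \<open>D\<close>. This is applied to closed subalgebras and, with
  \<open>D = UNIV\<close>, to the whole Banach algebra.\<close>

lemma neumann:
  fixes x :: "'a::{real_normed_algebra_1, banach}"
  assumes "closed D" "1 \<in> D" "\<And>x y. x \<in> D \<Longrightarrow> y \<in> D \<Longrightarrow> x + y \<in> D"
    "\<And>x y. x \<in> D \<Longrightarrow> y \<in> D \<Longrightarrow> x * y \<in> D" "0 \<in> D"
    and x: "x \<in> D" "norm x < 1"
  shows "\<exists>y\<in>D. (1 - x) * y = 1 \<and> y * (1 - x) = 1"
proof -
  have sm: "summable (\<lambda>n. x ^ n)" by (rule complete_algebra_summable_geometric[OF x(2)])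
  define y where "y = (\<Sum>n. x ^ n)"
  have pow: "x ^ n \<in> D" for n using assms by (induction n) auto
  have "(\<Sum>i<n. x ^ i) \<in> D" for n using assms pow by (induction n) auto
  moreover have "(\<lambda>n. \<Sum>i<n. x ^ i) \<longlonglongrightarrow> y"
    unfolding y_def by (rule summable_LIMSEQ[OF sm])
  ultimately have "y \<in> D" using assms(1) by (metis closed_sequentially)
  have split: "(\<Sum>n. x ^ Suc n) = y - 1"
    unfolding y_def using suminf_split_head[OF sm] by simp
  then have "x * y = y - 1" unfolding y_def by (simp add: suminf_mult[OF sm])
  moreover have "y * x = y - 1"
    using split unfolding y_def power_Suc2 by (simp add: suminf_mult2[OF sm])
  ultimately show ?thesis using \<open>y \<in> D\<close> by (intro bexI[of _ y]) (auto simp: algebra_simps)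
qed

lemma star_one [simp]: "star (1::'a::star_algebra_1) = 1"
  by (metis mult_1 mult.right_neutral star_mult star_star)

lemma star_minus: "star (- x::'a::star_algebra_1) = - star x"
  using star_scaleC[of "-1" x] by (simp add: scaleC_minus_left)

lemma star_diff: "star (x - y::'a::star_algebra_1) = star x - star y"
  using star_add[of x "- y"] by (simp add: star_minus)

lemma norm_star [simp]: "norm (star (x::'a::cstar_algebra_1)) = norm x"
proof -
  have "norm x \<le> norm (star x)" for x :: 'a
  proof (cases "x = 0")
    case False
    have "(norm x)\<^sup>2 \<le> norm (star x) * norm x"
      using norm_mult_ineq[of "star x" x] by (simp add: cstar_identity)
    then show ?thesis using False by (simp add: power2_eq_square)
  qed simp
  from this[of x] this[of "star x"] show ?thesis by (simp add: star_star)
qed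

text \<open>The C*-identity is iterated along repeated squaring; the exponents are those for which
  \<open>spectral_radius\<close> gives a bound.\<close>

lemma norm_self_adjoint_pow2:
  fixes x :: "'a::cstar_algebra_1"
  assumes "star x = x"
  shows "norm (x ^ 2 ^ m) = norm x ^ 2 ^ m"
proof (induction m)
  case (Suc m)
  have "star (x ^ n) = x ^ n" for n
    by (induction n) (simp_all add: star_mult assms power_commutes)
  moreover have "x ^ 2 ^ Suc m = x ^ 2 ^ m * x ^ 2 ^ m"
    by (simp flip: power_add) (simp add: mult_2)
  ultimately have "norm (x ^ 2 ^ Suc m) = (norm (x ^ 2 ^ m))\<^sup>2"
    by (metis cstar_identity)
  then show ?case using Suc by (simp add: mult.commute flip: power_mult)
qed simp

locale comm_cstar_subalgebra =
  fixes D :: "'b::cstar_algebra_1 set"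
  assumes star_subalg: "star_subalgebra D" and closed_D: "closed D"
    and comm: "\<And>x y. x \<in> D \<Longrightarrow> y \<in> D \<Longrightarrow> x * y = y * x"
begin

sublocale comm_subalgebra D
  using star_subalg comm by unfold_locales (auto simp: star_subalgebra_def)

lemma star_mem [simp, intro]: "x \<in> D \<Longrightarrow> star x \<in> D"
  using star_subalg by (auto simp: star_subalgebra_def)

sublocale norm: seminormed_subalgebra D norm
  by unfold_locales (auto simp: norm_triangle_ineq norm_scaleC norm_mult_ineq)

lemma neumann_D: "x \<in> D \<Longrightarrow> norm x < 1 \<Longrightarrow> \<exists>y\<in>D. (1 - x) * y = 1"
  using neumann[of D x] closed_D by auto

section \<open>Ideals and maximal ideals of a commutative C*-subalgebra\<close>

lemma ideal_minus: "alg_ideal D s \<Longrightarrow> x \<in> s \<Longrightarrow> - x \<in> s"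
  unfolding alg_ideal_def using minus_mem[OF one_mem] by (metis mult_1 mult_minus_left)

lemma ideal_scaleC: "alg_ideal D s \<Longrightarrow> x \<in> s \<Longrightarrow> c *\<^sub>C x \<in> s"
  unfolding alg_ideal_def using scaleC_mem[OF one_mem, of c] by (metis mult_1 mult_scaleC_left)

lemma ideal_add: "alg_ideal D s \<Longrightarrow> x \<in> s \<Longrightarrow> y \<in> s \<Longrightarrow> x + y \<in> s"
  by (auto simp: alg_ideal_def)

lemma ideal_diff: "alg_ideal D s \<Longrightarrow> x \<in> s \<Longrightarrow> y \<in> s \<Longrightarrow> x - y \<in> s"
  using ideal_add[of s x "- y"] ideal_minus by simp

lemma ideal_mult: "alg_ideal D s \<Longrightarrow> x \<in> s \<Longrightarrow> y \<in> D \<Longrightarrow> x * y \<in> s \<and> y * x \<in> s"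
  by (auto simp: alg_ideal_def)

lemma ideal_sub: "alg_ideal D s \<Longrightarrow> x \<in> s \<Longrightarrow> x \<in> D"
  by (auto simp: alg_ideal_def)

lemma ideal_zero: "alg_ideal D s \<Longrightarrow> 0 \<in> s"
  by (auto simp: alg_ideal_def)

lemma maximal_is_ideal: "s \<in> maximal_ideals D \<Longrightarrow> alg_ideal D s"
  by (auto simp: maximal_ideals_def)

lemma one_notin_maximal: 
  assumes "s \<in> maximal_ideals D" shows "1 \<notin> s"
proof
  assume "1 \<in> s"
  then have "D \<subseteq> s"
    using ideal_mult[OF maximal_is_ideal[OF assms], of 1] by auto
  then show False using assms by (auto simp: maximal_ideals_def alg_ideal_def)
qed

lemma unit_notin_maximal:
  assumes "s \<in> maximal_ideals D" "y \<in> D" "x * y = 1" shows "x \<notin> s"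
  using ideal_mult[OF maximal_is_ideal[OF assms(1)], of x y] one_notin_maximal[OF assms(1)] assms
  by auto

text \<open>For maximal \<open>s\<close> this ideal yields inverses modulo \<open>s\<close>; for the
  zero ideal it is the starting point of the Zorn argument.\<close>

lemma principal_ideal:
  assumes "alg_ideal D s" "z \<in> D"
  shows "alg_ideal D {z * y + w | y w. y \<in> D \<and> w \<in> s}"
proof -
  let ?J = "{z * y + w | y w. y \<in> D \<and> w \<in> s}"
  note I = ideal_zero[OF assms(1)] ideal_sub[OF assms(1)] ideal_add[OF assms(1)] ideal_mult[OF assms(1)]
  have "d * (z * y + w) \<in> ?J" if "d \<in> D" "y \<in> D" "w \<in> s" for d y w
  proof -
    have "d * (z * y + w) = z * (d * y) + d * w"
      using comm[of d z] assms that by (simp add: distrib_left flip: mult.assoc)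
    then show ?thesis using I that by blast
  qed
  moreover have "(z * y + w) * d = d * (z * y + w)" if "d \<in> D" "y \<in> D" "w \<in> s" for d y w
    using comm that I(2) assms(2) by auto
  moreover have "(z * y + w) + (z * y' + w') \<in> ?J" if "y \<in> D" "w \<in> s" "y' \<in> D" "w' \<in> s" for y w y' w'
  proof -
    have "(z * y + w) + (z * y' + w') = z * (y + y') + (w + w')" by (simp add: algebra_simps)
    then show ?thesis using I that by blast
  qed
  moreover have "0 \<in> ?J" using I by (auto intro!: exI[of _ 0])
  ultimately show ?thesis unfolding alg_ideal_def using I assms(2) by auto
qed

text \<open>The ideal generated by \<open>z\<close> and \<open>s\<close> is strictly larger than
  \<open>s\<close>, so by maximality it contains 1.\<close>

lemma inverse_mod_maximal:
  assumes s: "s \<in> maximal_ideals D" and z: "z \<in> D" "z \<notin> s"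
  shows "\<exists>y\<in>D. z * y - 1 \<in> s"
proof -
  let ?J = "{z * y + w | y w. y \<in> D \<and> w \<in> s}"
  note I = maximal_is_ideal[OF s]
  have "w = z * 0 + w" for w by simp
  then have sub: "s \<subseteq> ?J" using zero_mem by blast
  have "z = z * 1 + 0" by simp
  then have "z \<in> ?J" using ideal_zero[OF I] one_mem by blast
  then have "?J \<noteq> s" using z(2) by blast
  have "\<forall>J. alg_ideal D J \<and> s \<subseteq> J \<longrightarrow> J = s \<or> J = D"
    using s by (simp add: maximal_ideals_def)
  from spec[OF this, of ?J] have "?J = s \<or> ?J = D"
    using principal_ideal[OF I z(1)] sub by (rule mp[OF _ conjI])
  with \<open>?J \<noteq> s\<close> have "?J = D" by iprover
  then obtain y w where "y \<in> D" "w \<in> s" "1 = z * y + w" using one_mem by blast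
  then have "y \<in> D" "z * y - 1 = - w" "w \<in> s" by (auto simp: algebra_simps)
  then show ?thesis using ideal_minus[OF I] by metis
qed

text \<open>Zorn's lemma is applied to the ideals that contain \<open>z\<close> but not 1.
  Properness is phrased as omitting 1 because that survives unions of chains.\<close>

lemma maximal_ideal_exists:
  assumes z: "z \<in> D" and nu: "\<And>y. y \<in> D \<Longrightarrow> z * y \<noteq> 1"
  shows "\<exists>s\<in>maximal_ideals D. z \<in> s"
proof -
  let ?A = "{J. alg_ideal D J \<and> z \<in> J \<and> 1 \<notin> J}"
  have zero: "alg_ideal D {0}" by (auto simp: alg_ideal_def)
  have "{z * y + w | y w. y \<in> D \<and> w \<in> {0}} \<in> ?A"
    using principal_ideal[OF zero z] nu z by (auto simp: eq_commute[of 1] intro!: exI[of _ 1])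
  then have "?A \<noteq> {}" by blast
  moreover have "\<Union>\<C> \<in> ?A" if "\<C> \<noteq> {}" "subset.chain ?A \<C>" for \<C>
  proof -
    have sub: "\<C> \<subseteq> ?A" and total: "\<And>X Y. X \<in> \<C> \<Longrightarrow> Y \<in> \<C> \<Longrightarrow> X \<subseteq> Y \<or> Y \<subseteq> X"
      using that(2) by (auto simp: subset_chain_def)
    have "x + y \<in> \<Union>\<C>" if "x \<in> \<Union>\<C>" "y \<in> \<Union>\<C>" for x y
    proof -
      obtain X Y where "X \<in> \<C>" "x \<in> X" "Y \<in> \<C>" "y \<in> Y" using \<open>x \<in> \<Union>\<C>\<close> \<open>y \<in> \<Union>\<C>\<close> by blast
      then obtain Z where "Z \<in> \<C>" "x \<in> Z" "y \<in> Z" using total[of X Y] by blast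
      then show ?thesis using sub ideal_add by blast
    qed
    moreover have "0 \<in> \<Union>\<C>" using sub that(1) ideal_zero by blast
    moreover have "d * x \<in> \<Union>\<C> \<and> x * d \<in> \<Union>\<C>" if "d \<in> D" "x \<in> \<Union>\<C>" for d x
      using that sub ideal_mult by blast
    moreover have "\<Union>\<C> \<subseteq> D" using sub ideal_sub by blast
    ultimately have "alg_ideal D (\<Union>\<C>)" unfolding alg_ideal_def by blast
    then show ?thesis using sub that(1) by blast
  qed
  ultimately obtain s where s: "s \<in> ?A" "\<And>X. X \<in> ?A \<Longrightarrow> s \<subseteq> X \<Longrightarrow> X = s"
    using subset_Zorn_nonempty[of ?A] by blast
  have "J = s \<or> J = D" if "alg_ideal D J" "s \<subseteq> J" for J
  proof (cases "1 \<in> J")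
    case True
    then have "J = D" using ideal_mult[OF that(1), of 1] ideal_sub[OF that(1)] by auto
    then show ?thesis ..
  next
    case False
    then show ?thesis using s that by blast
  qed
  moreover have "s \<noteq> D" using s one_mem by blast
  ultimately have "s \<in> maximal_ideals D" using s by (auto simp: maximal_ideals_def)
  then show ?thesis using s by blast
qed

section \<open>The quotient seminorm and the Gelfand-Mazur theorem\<close>

lemma quotient_seminorm:
  assumes I: "alg_ideal D s"
  shows "seminormed_subalgebra D (\<lambda>x. infdist x s)"
proof unfold_locales
  have ne: "s \<noteq> {}" using ideal_zero[OF I] by blast
  fix x y assume x: "x \<in> D" and y: "y \<in> D"
  have "infdist (x + y) s - dist y w \<le> 1 * infdist x s" if w: "w \<in> s" for w
  proof (rule mult_infdist_ge[OF ne])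
    fix z assume "z \<in> s"
    then have "infdist (x + y) s \<le> dist (x + y) (z + w)"
      using w I ideal_add by (intro infdist_le) auto
    also have "\<dots> \<le> dist x z + dist y w" by (rule dist_triangle_add)
    finally show "infdist (x + y) s - dist y w \<le> 1 * dist x z" by simp
  qed simp
  then have "infdist (x + y) s - infdist x s \<le> 1 * infdist y s"
    by (intro mult_infdist_ge[OF ne]) (auto simp: algebra_simps)
  then show "infdist (x + y) s \<le> infdist x s + infdist y s" by simp
  have "infdist (x * y) s \<le> dist y w * infdist x s" if w: "w \<in> s" for w
  proof (rule mult_infdist_ge[OF ne])
    fix z assume z: "z \<in> s"
    \<comment> \<open>Subtracting this element of the ideal from \<open>x * y\<close> leaves
      \<open>(x - z) * (y - w)\<close>, to which submultiplicativity of the norm applies.\<close>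
    have "x * w + z * y - z * w \<in> s"
      using z w x y I by (intro ideal_diff[OF I] ideal_add[OF I]) (auto simp: ideal_mult ideal_sub)
    then have "infdist (x * y) s \<le> dist (x * y) (x * w + z * y - z * w)" by (rule infdist_le)
    also have "\<dots> = norm ((x - z) * (y - w))" by (simp add: dist_norm algebra_simps)
    also have "\<dots> \<le> dist y w * dist x z"
      by (simp add: dist_norm mult.commute[of "norm (y - w)"] norm_mult_ineq)
    finally show "infdist (x * y) s \<le> dist y w * dist x z" .
  qed simp
  then show "infdist (x * y) s \<le> infdist x s * infdist y s"
    by (intro mult_infdist_ge[OF ne]) (auto simp: mult.commute infdist_nonneg)
next
  have ne: "s \<noteq> {}" using ideal_zero[OF I] by blast
  fix x c assume x: "x \<in> D"
  have le: "infdist (c *\<^sub>C x) s \<le> cmod c * infdist x s" for c x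
  proof (rule mult_infdist_ge[OF ne])
    fix z assume "z \<in> s"
    then have "infdist (c *\<^sub>C x) s \<le> dist (c *\<^sub>C x) (c *\<^sub>C z)"
      by (intro infdist_le ideal_scaleC[OF I])
    then show "infdist (c *\<^sub>C x) s \<le> cmod c * dist x z"
      by (simp add: dist_norm norm_scaleC flip: scaleC_diff_right)
  qed simp
  show "infdist (c *\<^sub>C x) s = cmod c * infdist x s"
  proof (cases "c = 0")
    case True
    then show ?thesis using ideal_zero[OF I] by simp
  next
    case False
    then have "cmod c * infdist x s \<le> infdist (c *\<^sub>C x) s"
      using le[of "inverse c" "c *\<^sub>C x"]
      by (simp add: scaleC_scaleC norm_inverse) (simp add: field_simps)
    then show ?thesis using le[of c x] by simp
  qed
qed

text \<open>Otherwise every \<open>x - c *\<^sub>C 1\<close> is invertible modulo \<open>s\<close>.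
  Let \<open>y\<close> invert \<open>x\<close> modulo \<open>s\<close>. No element of
  \<open>s\<close> is within distance less than 1 of the unit, by the Neumann series, so the
  quotient seminorms of \<open>x ^ n\<close> and \<open>y\<close> satisfy
  \<open>1 \<le> q (x ^ n) * q y ^ n\<close> for all \<open>n\<close>. This contradicts
  \<open>spectral_radius\<close> for the radius \<open>1 / q y\<close>.\<close>

lemma Gelfand_Mazur:
  assumes s: "s \<in> maximal_ideals D" and x: "x \<in> D"
  shows "\<exists>c. x - c *\<^sub>C 1 \<in> s"
proof (rule ccontr)
  assume contr: "\<not> ?thesis"
  note I = maximal_is_ideal[OF s]
  interpret q: seminormed_subalgebra D "\<lambda>x. infdist x s" by (rule quotient_seminorm[OF I])
  have inv: "\<exists>y\<in>D. (x - c *\<^sub>C 1) * y - 1 \<in> s" for c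
    using inverse_mod_maximal[OF s, of "x - c *\<^sub>C 1"] contr x by auto
  from this[of 0] obtain y where y: "y \<in> D" "x * y - 1 \<in> s" by auto
  have "1 \<le> 1 * infdist 1 s"
  proof (rule mult_infdist_ge)
    fix z assume z: "z \<in> s"
    have "\<not> norm (1 - z) < 1"
    proof
      assume "norm (1 - z) < 1"
      then obtain v where "v \<in> D" "z * v = 1"
        using neumann_D[of "1 - z"] ideal_sub[OF I z] by auto
      then show False using unit_notin_maximal[OF s] z by blast
    qed
    then show "1 \<le> 1 * dist 1 z" by (simp add: dist_norm)
  qed (use ideal_zero[OF I] in auto)
  then have one: "1 \<le> infdist 1 s" by simp
  have low: "1 \<le> infdist (x ^ n) s * infdist y s ^ n" for n
  proof -
    have "x ^ n * y ^ n - 1 \<in> s"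
    proof (induction n)
      case 0
      then show ?case using ideal_zero[OF I] by simp
    next
      case (Suc n)
      have "x ^ Suc n * y ^ Suc n - 1 = (x ^ n * y ^ n) * (x * y - 1) + (x ^ n * y ^ n - 1)"
        using comm[of x "y ^ n"] x y by (simp add: algebra_simps power_Suc2 del: power_Suc) 
          (metis mult.assoc)
      also have "\<dots> \<in> s" using Suc y x by (intro ideal_add[OF I] ideal_mult[OF I, THEN conjunct2]) auto
      finally show ?case .
    qed
    then have "infdist (x ^ n * y ^ n - 1) s = 0" by simp
    moreover have "infdist 1 s \<le> infdist (x ^ n * y ^ n) s + infdist (x ^ n * y ^ n - 1) s"
      using q.q_diff[of "x ^ n * y ^ n" "x ^ n * y ^ n - 1"] x y by auto
    ultimately have "1 \<le> infdist (x ^ n * y ^ n) s" using one by simp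
    also have "\<dots> \<le> infdist (x ^ n) s * infdist (y ^ n) s" using x y by (intro q.q_mult) auto
    also have "infdist (y ^ n) s \<le> infdist y s ^ n"
    proof (induction n)
      case 0
      then show ?case using infdist_le[OF ideal_zero[OF I], of 1] by simp
    next
      case (Suc n)
      then show ?case using q.q_mult[of y "y ^ n"] y mult_left_mono[OF Suc, of "infdist y s"]
        by (simp add: infdist_nonneg)
    qed
    finally show ?thesis by (simp add: mult_left_mono infdist_nonneg)
  qed
  have pos: "infdist y s > 0"
    using low[of 1] infdist_nonneg[of y s] by (cases "infdist y s = 0") auto
  obtain m where m: "infdist (x ^ 2 ^ m) s < (1 / infdist y s) ^ 2 ^ m"
  proof -
    have "\<exists>v\<in>D. infdist ((x - z *\<^sub>C 1) * v - 1) s = 0" for z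
      using inv[of z] by (auto intro!: bexI)
    then show ?thesis using q.spectral_radius[OF x, of "1 / infdist y s"] pos that by auto
  qed
  then have "infdist (x ^ 2 ^ m) s * infdist y s ^ 2 ^ m < 1"
    using pos by (simp add: power_divide field_simps)
  then show False using low[of "2 ^ m"] by simp
qed

section \<open>Algebraic and metric properties of the Gelfand transform\<close>

lemma gelfand_eqI:
  assumes s: "s \<in> maximal_ideals D" and c: "x - c *\<^sub>C 1 \<in> s"
  shows "gelfand x s = c"
  unfolding gelfand_def
proof (rule the_equality)
  note I = maximal_is_ideal[OF s]
  fix d assume "x - d *\<^sub>C 1 \<in> s"
  then have "(x - d *\<^sub>C 1) - (x - c *\<^sub>C 1) \<in> s" using c ideal_diff[OF I] by blast
  then have mem: "(c - d) *\<^sub>C 1 \<in> s" by (simp add: scaleC_diff_left)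
  show "d = c"
  proof (rule ccontr)
    assume "d \<noteq> c"
    then have "inverse (c - d) *\<^sub>C (c - d) *\<^sub>C (1::'b) = 1" by (simp add: scaleC_scaleC)
    then show False using ideal_scaleC[OF I mem, of "inverse (c - d)"] one_notin_maximal[OF s] by simp
  qed
qed (use c in simp)

lemma gelfand_mem:
  assumes "s \<in> maximal_ideals D" "x \<in> D" shows "x - gelfand x s *\<^sub>C 1 \<in> s"
  using Gelfand_Mazur[OF assms] gelfand_eqI[OF assms(1)] by metis

lemma gelfand_scalar: "s \<in> maximal_ideals D \<Longrightarrow> gelfand (c *\<^sub>C 1) s = c"
  by (rule gelfand_eqI) (auto simp: ideal_zero maximal_is_ideal)

lemma gelfand_one: "s \<in> maximal_ideals D \<Longrightarrow> gelfand 1 s = 1"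
  using gelfand_scalar[of s 1] by simp

lemma gelfand_add:
  assumes s: "s \<in> maximal_ideals D" and "x \<in> D" "y \<in> D"
  shows "gelfand (x + y) s = gelfand x s + gelfand y s"
proof (rule gelfand_eqI[OF s])
  have "x + y - (gelfand x s + gelfand y s) *\<^sub>C 1 = (x - gelfand x s *\<^sub>C 1) + (y - gelfand y s *\<^sub>C 1)"
    by (simp add: scaleC_add_left)
  also have "\<dots> \<in> s"
    using gelfand_mem assms ideal_add[OF maximal_is_ideal[OF s]] by blast
  finally show "x + y - (gelfand x s + gelfand y s) *\<^sub>C 1 \<in> s" .
qed

lemma gelfand_mult:
  assumes s: "s \<in> maximal_ideals D" and x: "x \<in> D" and y: "y \<in> D"
  shows "gelfand (x * y) s = gelfand x s * gelfand y s"
proof (rule gelfand_eqI[OF s])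
  note I = maximal_is_ideal[OF s]
  have "x * y - (gelfand x s * gelfand y s) *\<^sub>C 1 =
      (x - gelfand x s *\<^sub>C 1) * y + gelfand x s *\<^sub>C (y - gelfand y s *\<^sub>C 1)"
    by (simp add: scaleC_simps algebra_simps)
  also have "\<dots> \<in> s"
    using gelfand_mem[OF s x] gelfand_mem[OF s y] y
    by (intro ideal_add[OF I] ideal_scaleC[OF I] ideal_mult[OF I, THEN conjunct1])
  finally show "x * y - (gelfand x s * gelfand y s) *\<^sub>C 1 \<in> s" .
qed

lemma gelfand_scaleC:
  assumes s: "s \<in> maximal_ideals D" and x: "x \<in> D"
  shows "gelfand (c *\<^sub>C x) s = c * gelfand x s"
  using gelfand_mult[OF s, of "c *\<^sub>C 1" x] x gelfand_scalar[OF s] by (simp add: mult_scaleC_left)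

lemma gelfand_diff:
  assumes s: "s \<in> maximal_ideals D" and x: "x \<in> D" and y: "y \<in> D"
  shows "gelfand (x - y) s = gelfand x s - gelfand y s"
  using gelfand_add[OF s x, of "(-1) *\<^sub>C y"] gelfand_scaleC[OF s y, of "-1"] y
  by (simp add: scaleC_minus_left)

text \<open>If \<open>c\<close> exceeds \<open>x\<close> in modulus, the Neumann series inverts
  \<open>x - c *\<^sub>C 1\<close>, which then lies in no maximal ideal.\<close>

lemma gelfand_le_norm:
  assumes s: "s \<in> maximal_ideals D" and x: "x \<in> D"
  shows "cmod (gelfand x s) \<le> norm x"
proof (rule ccontr)
  define c where "c = gelfand x s"
  assume "\<not> ?thesis"
  then have less: "norm x < cmod c" by (simp add: c_def)
  then have c0: "c \<noteq> 0" using norm_ge_zero[of x] by fastforce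
  have "norm ((1 / c) *\<^sub>C x) < 1" using less c0 by (simp add: norm_scaleC norm_divide)
  then obtain y where y: "y \<in> D" "(1 - (1 / c) *\<^sub>C x) * y = 1"
    using neumann_D x by blast
  have "(x - c *\<^sub>C 1) * ((- 1 / c) *\<^sub>C y) = (1 - (1 / c) *\<^sub>C x) * y"
    using c0 by (simp add: scaleC_simps algebra_simps)
  then show False using unit_notin_maximal[OF s, of "(- 1 / c) *\<^sub>C y"] y gelfand_mem[OF s x]
    by (auto simp: c_def)
qed

text \<open>Arens' trick: comparing value and norm of \<open>x\<close> shifted by an imaginary
  scalar of size \<open>t\<close>, the squares of \<open>t\<close> cancel and leave a bound on a
  term linear in \<open>t\<close>, so its coefficient vanishes.\<close>

lemma gelfand_real:
  assumes s: "s \<in> maximal_ideals D" and x: "x \<in> D" and sa: "star x = x"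
  shows "Im (gelfand x s) = 0"
proof (rule ccontr)
  define c where "c = gelfand x s"
  assume "\<not> ?thesis"
  then have Im: "Im c \<noteq> 0" by (simp add: c_def)
  have bound: "(cmod c)\<^sup>2 + 2 * t * Im c \<le> (norm x)\<^sup>2" for t :: real
  proof -
    let ?z = "x + (\<i> * of_real t) *\<^sub>C 1"
    have "gelfand ?z s = c + \<i> * of_real t"
      using gelfand_add[OF s x] gelfand_scalar[OF s] by (simp add: c_def)
    then have "(cmod (c + \<i> * of_real t))\<^sup>2 \<le> (norm ?z)\<^sup>2"
      using gelfand_le_norm[OF s, of ?z] x by (intro power_mono) auto
    also have "(norm ?z)\<^sup>2 = norm (star ?z * ?z)" by (simp add: cstar_identity)
    also have "star ?z * ?z = x * x + (of_real t * of_real t) *\<^sub>C 1"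
      by (simp add: star_add star_scaleC sa scaleC_simps algebra_simps)
    also have "norm \<dots> \<le> norm (x * x) + t\<^sup>2"
      by (rule order_trans[OF norm_triangle_ineq]) (simp add: norm_scaleC norm_mult power2_eq_square)
    also have "norm (x * x) = (norm x)\<^sup>2" using cstar_identity[of x] sa by simp
    also have "(cmod (c + \<i> * of_real t))\<^sup>2 = (cmod c)\<^sup>2 + 2 * t * Im c + t\<^sup>2"
      by (simp only: cmod_power2) (simp add: power2_eq_square algebra_simps)
    finally show ?thesis by simp
  qed
  \<comment> \<open>This value of \<open>t\<close> makes the linear term exceed the right-hand side
    of \<open>bound\<close> by 1.\<close>
  have "2 * (((norm x)\<^sup>2 + 1) / (2 * Im c)) * Im c = (norm x)\<^sup>2 + 1" using Im by simp
  then show False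
    using bound[of "((norm x)\<^sup>2 + 1) / (2 * Im c)"] zero_le_power2[of "cmod c"] by linarith
qed

lemma gelfand_of_real:
  assumes "s \<in> maximal_ideals D" "x \<in> D" "star x = x"
  shows "gelfand x s = of_real (Re (gelfand x s))"
  using gelfand_real[OF assms] by (simp add: complex_eq_iff)

text \<open>A scalar \<open>z\<close> for which \<open>x - z *\<^sub>C 1\<close> has no inverse in
  \<open>D\<close> is a value of the transform. If all values were below the norm,
  \<open>spectral_radius\<close> would make some power of \<open>x\<close> too small for
  \<open>norm_self_adjoint_pow2\<close>.\<close>

lemma norm_le_gelfand:
  assumes x: "x \<in> D" and sa: "star x = x" and r: "0 \<le> r"
    and le: "\<And>s. s \<in> maximal_ideals D \<Longrightarrow> cmod (gelfand x s) \<le> r"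
  shows "norm x \<le> r"
proof (rule ccontr)
  assume "\<not> ?thesis"
  then have less: "r < norm x" by simp
  have "\<exists>y\<in>D. norm ((x - z *\<^sub>C 1) * y - 1) = 0" if "cmod z \<ge> norm x" for z
  proof (rule ccontr)
    assume "\<not> ?thesis"
    then obtain s where s: "s \<in> maximal_ideals D" "x - z *\<^sub>C 1 \<in> s"
      using maximal_ideal_exists[of "x - z *\<^sub>C 1"] x by auto
    then show False using gelfand_eqI[OF s] le[OF s(1)] that less by simp
  qed
  then obtain m where "norm (x ^ 2 ^ m) < norm x ^ 2 ^ m"
    using norm.spectral_radius[OF x, of "norm x"] less r by force
  then show False using norm_self_adjoint_pow2[OF sa] by simp
qed

text \<open>The self-adjoint element \<open>star z * z\<close> reduces this to
  \<open>norm_le_gelfand\<close> with bound 0, and the C*-identity returns to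
  \<open>z\<close>.\<close>

lemma semisimple:
  assumes z: "z \<in> D" and null: "\<And>s. s \<in> maximal_ideals D \<Longrightarrow> gelfand z s = 0"
  shows "z = 0"
proof -
  have "norm (star z * z) \<le> 0"
    using z null by (intro norm_le_gelfand) (auto simp: star_mult star_star gelfand_mult)
  then show ?thesis by (simp add: cstar_identity)
qed

section \<open>Functional calculus of a self-adjoint element\<close>

lemma polynomial_calculus:
  assumes h: "h \<in> D" "star h = h" and p: "real_polynomial_function p"
  shows "\<exists>g\<in>D. star g = g \<and> (\<forall>s\<in>maximal_ideals D. gelfand g s = of_real (p (Re (gelfand h s))))"
  using p
proof induction
  case (linear f)
  then obtain c where f: "f = (\<lambda>t. t * c)" by (auto simp: real_bounded_linear)
  have "star (of_real c *\<^sub>C h) = of_real c *\<^sub>C h" by (simp add: star_scaleC h)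
  then show ?case using h
    by (intro bexI[of _ "of_real c *\<^sub>C h"])
       (auto simp: gelfand_scaleC f mult.commute gelfand_of_real[symmetric])
next
  case (const c)
  show ?case
    by (intro bexI[of _ "of_real c *\<^sub>C 1"]) (auto simp: gelfand_scalar star_scaleC)
next
  case (add f g)
  then obtain u v where "u \<in> D" "star u = u" "v \<in> D" "star v = v"
    "\<forall>s\<in>maximal_ideals D. gelfand u s = of_real (f (Re (gelfand h s)))"
    "\<forall>s\<in>maximal_ideals D. gelfand v s = of_real (g (Re (gelfand h s)))" by blast
  then show ?case by (intro bexI[of _ "u + v"]) (auto simp: gelfand_add star_add)
next
  case (mult f g)
  then obtain u v where "u \<in> D" "star u = u" "v \<in> D" "star v = v"
    "\<forall>s\<in>maximal_ideals D. gelfand u s = of_real (f (Re (gelfand h s)))"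
    "\<forall>s\<in>maximal_ideals D. gelfand v s = of_real (g (Re (gelfand h s)))" by blast
  then show ?case by (intro bexI[of _ "u * v"]) (auto simp: gelfand_mult star_mult comm)
qed

text \<open>Uniform polynomial approximations of \<phi> give self-adjoint elements that form a
  Cauchy sequence by \<open>norm_le_gelfand\<close>; the limit is in \<open>D\<close> because
  \<open>D\<close> is closed.\<close>

lemma continuous_calculus:
  assumes h: "h \<in> D" "star h = h" and phi: "continuous_on {- norm h..norm h} \<phi>"
  shows "\<exists>g\<in>D. star g = g \<and> (\<forall>s\<in>maximal_ideals D. gelfand g s = of_real (\<phi> (Re (gelfand h s))))"
proof -
  let ?S = "{- norm h..norm h}"
  have "\<exists>p. real_polynomial_function p \<and> (\<forall>t\<in>?S. \<bar>\<phi> t - p t\<bar> < inverse (real (Suc n)))" for n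
    by (rule Stone_Weierstrass_real_polynomial_function[OF compact_Icc phi, of "inverse (real (Suc n))"])
      (simp, blast)
  then obtain p where p: "\<And>n. real_polynomial_function (p n)"
    "\<And>n t. t \<in> ?S \<Longrightarrow> \<bar>\<phi> t - p n t\<bar> < inverse (real (Suc n))" by metis
  obtain g where g: "\<And>n. g n \<in> D" "\<And>n. star (g n) = g n"
    "\<And>n s. s \<in> maximal_ideals D \<Longrightarrow> gelfand (g n) s = of_real (p n (Re (gelfand h s)))"
    using polynomial_calculus[OF h p(1)] by metis
  have range: "Re (gelfand h s) \<in> ?S" if "s \<in> maximal_ideals D" for s
    using gelfand_le_norm[OF that h(1)] abs_Re_le_cmod[of "gelfand h s"] by auto
  have diff: "norm (g m - g n) \<le> inverse (real (Suc m)) + inverse (real (Suc n))" for m n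
  proof (rule norm_le_gelfand)
    fix s assume s: "s \<in> maximal_ideals D"
    let ?t = "Re (gelfand h s)"
    have "cmod (gelfand (g m - g n) s) = \<bar>p m ?t - p n ?t\<bar>"
      using s g by (simp add: gelfand_diff flip: of_real_diff)
    also have "\<dots> \<le> inverse (real (Suc m)) + inverse (real (Suc n))"
      using p(2)[OF range[OF s], of m] p(2)[OF range[OF s], of n] by linarith
    finally show "cmod (gelfand (g m - g n) s) \<le> inverse (real (Suc m)) + inverse (real (Suc n))" .
  qed (use g in \<open>auto simp: star_diff\<close>)
  have "Cauchy g"
  proof (rule CauchyI)
    fix e :: real assume "0 < e"
    then obtain N where N: "inverse (real (Suc N)) < e / 2" using reals_Archimedean[of "e / 2"] by auto
    have "norm (g m - g n) < e" if "m \<ge> N" "n \<ge> N" for m n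
    proof -
      have "inverse (real (Suc m)) \<le> inverse (real (Suc N))" "inverse (real (Suc n)) \<le> inverse (real (Suc N))"
        using that by (auto intro!: le_imp_inverse_le)
      then show ?thesis using diff[of m n] N by linarith
    qed
    then show "\<exists>N. \<forall>m\<ge>N. \<forall>n\<ge>N. norm (g m - g n) < e" by blast
  qed
  then obtain l where l: "g \<longlonglongrightarrow> l" using Cauchy_convergent convergent_def by blast
  have lD: "l \<in> D" using closed_D g(1) l by (metis closed_sequentially)
  have norm0: "(\<lambda>n. norm (g n - l)) \<longlonglongrightarrow> 0"
    using l by (simp add: LIM_zero tendsto_norm_zero)
  have "(\<lambda>n. norm (star (g n) - star l)) \<longlonglongrightarrow> 0"
    using norm0 by (simp flip: star_diff)
  then have "g \<longlonglongrightarrow> star l" using g(2) by (simp add: LIM_zero_cancel tendsto_norm_zero_iff)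
  then have "star l = l" using l LIMSEQ_unique by blast
  moreover have "gelfand l s = of_real (\<phi> (Re (gelfand h s)))" if s: "s \<in> maximal_ideals D" for s
  proof -
    have "cmod (gelfand (g n) s - gelfand l s) \<le> norm (g n - l)" for n
      using gelfand_le_norm[OF s, of "g n - l"] g(1) lD gelfand_diff[OF s] by simp
    then have "(\<lambda>n. gelfand (g n) s - gelfand l s) \<longlonglongrightarrow> 0"
      by (intro Lim_null_comparison[OF _ norm0] always_eventually allI)
    then have 1: "(\<lambda>n. gelfand (g n) s) \<longlonglongrightarrow> gelfand l s" by (rule LIM_zero_cancel)
    have "norm (p n (Re (gelfand h s)) - \<phi> (Re (gelfand h s))) \<le> inverse (real (Suc n))" for n
      using p(2)[OF range[OF s], of n] by (simp only: real_norm_def abs_minus_commute less_imp_le)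
    then have "(\<lambda>n. p n (Re (gelfand h s)) - \<phi> (Re (gelfand h s))) \<longlonglongrightarrow> 0"
      by (intro Lim_null_comparison[OF _ LIMSEQ_inverse_real_of_nat] always_eventually allI)
    then have "(\<lambda>n. of_real (p n (Re (gelfand h s))) :: complex) \<longlonglongrightarrow> of_real (\<phi> (Re (gelfand h s)))"
      by (intro tendsto_of_real) (rule LIM_zero_cancel)
    then show ?thesis using 1 g(3)[OF s] LIMSEQ_unique by simp
  qed
  ultimately show ?thesis using lD by blast
qed

section \<open>Closed sets in the maximal ideal space\<close>

lemma topspace_max_ideal_space: "topspace (max_ideal_space D) = maximal_ideals D"
  unfolding max_ideal_space_def topology_generated_by_topspace using one_mem by auto

lemma closedin_gelfand_vimage:
  assumes "x \<in> D" "closed F"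
  shows "closedin (max_ideal_space D) {s \<in> maximal_ideals D. gelfand x s \<in> F}"
proof -
  have "maximal_ideals D - {s \<in> maximal_ideals D. gelfand x s \<in> F} =
      {s \<in> maximal_ideals D. gelfand x s \<in> - F}" by auto
  moreover have "openin (max_ideal_space D) {s \<in> maximal_ideals D. gelfand x s \<in> - F}"
    unfolding max_ideal_space_def using assms(1) open_Compl[OF assms(2)]
    by (intro topology_generated_by_Basis) blast
  ultimately show ?thesis by (simp add: closedin_def topspace_max_ideal_space)
qed

end


section \<open>Separation by local normality\<close>

text \<open>Normality gives no control of \<open>y\<close> in norm; only the elements \<open>g\<close> and \<open>k\<close>, obtained from
  \<open>h\<close> by functional calculus and in general outside \<open>C\<close>, are bounded.\<close>

lemma separating_elements:
  fixes h :: "'b::cstar_algebra_1"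
  assumes "locally_normal C" "h \<in> C" and sa: "star h = h"
  obtains y g k where "y \<in> C" "y * g * h = y" "norm g \<le> 64" "k * y = k" "star k = k"
    "norm ((1 - k) * h * (1 - k)) \<le> 1/16"
proof -
  obtain D where D: "star_subalgebra D" "closed D" "\<And>y z. y \<in> D \<Longrightarrow> z \<in> D \<Longrightarrow> y * z = z * y"
    and h: "h \<in> D" and normal: "normal_in (D \<inter> C) D"
    using assms unfolding locally_normal_def by blast
  interpret comm_cstar_subalgebra D using D by unfold_locales
  \<comment> \<open>Truncated inversion: since 4096 is the square of 64, this is
    \<open>1 / t\<close> once \<bar>t\<bar> is at least 1/64, and it is bounded by 64
    everywhere.\<close>
  define \<phi> :: "real \<Rightarrow> real" where "\<phi> t = t / max (t\<^sup>2) (1/4096)" for t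
  \<comment> \<open>A cutoff that is 0 up to \<bar>t\<bar> = 1/32 and 1 from \<bar>t\<bar> = 1/16
    on.\<close>
  define \<kappa> :: "real \<Rightarrow> real" where "\<kappa> t = min 1 (max 0 (32 * \<bar>t\<bar> - 1))" for t
  have nz: "max (t\<^sup>2) (1/4096) \<noteq> 0" for t :: real by linarith
  have "continuous_on {- norm h..norm h} \<phi>"
    unfolding \<phi>_def using nz by (intro continuous_intros) auto
  from continuous_calculus[OF h sa this] obtain g where
    g: "g \<in> D" "star g = g" "\<And>s. s \<in> maximal_ideals D \<Longrightarrow> gelfand g s = of_real (\<phi> (Re (gelfand h s)))"
    by blast
  have "continuous_on {- norm h..norm h} \<kappa>"
    unfolding \<kappa>_def by (intro continuous_intros)
  from continuous_calculus[OF h sa this] obtain k where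
    k: "k \<in> D" "star k = k" "\<And>s. s \<in> maximal_ideals D \<Longrightarrow> gelfand k s = of_real (\<kappa> (Re (gelfand h s)))"
    by blast
  note real = gelfand_of_real[OF _ h sa]
  have abs: "cmod (gelfand h s) = \<bar>Re (gelfand h s)\<bar>" if "s \<in> maximal_ideals D" for s
    using real[OF that] by (metis norm_of_real)
  \<comment> \<open>\<open>T1\<close> covers the points where \<open>\<phi> t * t\<close> differs
    from 1, and \<open>T2\<close> those where \<kappa> is nonzero. The gap between 1/64 and 1/32
    keeps them disjoint.\<close>
  define T1 where "T1 = {s \<in> maximal_ideals D. gelfand h s \<in> cball 0 (1/64)}"
  define T2 where "T2 = {s \<in> maximal_ideals D. gelfand h s \<in> {z. 1/32 \<le> cmod z}}"
  have "closedin (max_ideal_space D) T1" unfolding T1_def by (rule closedin_gelfand_vimage[OF h]) simp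
  moreover have "closed {z. 1/32 \<le> cmod z}" by (intro closed_Collect_le continuous_intros)
  then have "closedin (max_ideal_space D) T2" unfolding T2_def by (rule closedin_gelfand_vimage[OF h])
  moreover have "T1 \<inter> T2 = {}" unfolding T1_def T2_def by auto
  ultimately have "\<exists>y\<in>D \<inter> C. (\<forall>s\<in>T1. gelfand y s = 0) \<and> (\<forall>s\<in>T2. gelfand y s = 1)"
    using normal unfolding normal_in_def by simp
  then obtain y where y: "y \<in> D" "y \<in> C" "\<And>s. s \<in> T1 \<Longrightarrow> gelfand y s = 0"
    "\<And>s. s \<in> T2 \<Longrightarrow> gelfand y s = 1"
    by blast
  show thesis
  proof
    show "y \<in> C" by fact
    have "y * g * h - y = 0"
    proof (rule semisimple)
      fix s assume s: "s \<in> maximal_ideals D"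
      define t where "t = Re (gelfand h s)"
      have "gelfand (y * g * h - y) s = gelfand y s * (of_real (\<phi> t * t) - 1)"
        using y g h s real[OF s] by (simp add: gelfand_diff gelfand_mult t_def algebra_simps)
      moreover have "gelfand y s = 0 \<or> \<phi> t * t = 1"
      proof (cases "\<bar>t\<bar> \<le> 1/64")
        case True
        then show ?thesis using y(3)[of s] s abs[OF s] by (auto simp: T1_def t_def)
      next
        case False
        then have "(1/64)\<^sup>2 \<le> \<bar>t\<bar>\<^sup>2" by (intro power_mono) auto
        then have "max (t\<^sup>2) (1/4096) = t\<^sup>2" by (simp add: power2_eq_square)
        then show ?thesis using False by (auto simp: \<phi>_def power2_eq_square)
      qed
      ultimately show "gelfand (y * g * h - y) s = 0" by (metis diff_self mult_zero_left mult_zero_right of_real_1)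
    qed (use y g h in auto)
    then show "y * g * h = y" by simp
    show "norm g \<le> 64"
    proof (rule norm_le_gelfand)
      fix s assume s: "s \<in> maximal_ideals D"
      define t where "t = Re (gelfand h s)"
      have "\<bar>t\<bar> \<le> 64 * max (t\<^sup>2) (1/4096)"
      proof (cases "\<bar>t\<bar> \<le> 1/64")
        case False
        then have "1/64 * \<bar>t\<bar> \<le> \<bar>t\<bar> * \<bar>t\<bar>" by (intro mult_right_mono) auto
        then show ?thesis by (simp add: power2_eq_square)
      qed auto
      then have "\<bar>\<phi> t\<bar> \<le> 64" using nz[of t] by (simp add: \<phi>_def abs_divide divide_le_eq)
      then show "cmod (gelfand g s) \<le> 64" using g s by (simp add: t_def)
    qed (use g in auto)
    have "k * y - k = 0"
    proof (rule semisimple)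
      fix s assume s: "s \<in> maximal_ideals D"
      define t where "t = Re (gelfand h s)"
      have "gelfand (k * y - k) s = of_real (\<kappa> t) * (gelfand y s - 1)"
        using y k s by (simp add: gelfand_diff gelfand_mult t_def algebra_simps)
      moreover have "gelfand y s = 1 \<or> \<kappa> t = 0"
      proof (cases "\<bar>t\<bar> \<le> 1/32")
        case False
        then show ?thesis using y(4)[of s] s abs[OF s] by (auto simp: T2_def t_def)
      qed (auto simp: \<kappa>_def)
      ultimately show "gelfand (k * y - k) s = 0" by auto
    qed (use y k in auto)
    then show "k * y = k" by simp
    show "star k = k" by fact
    \<comment> \<open>Where the transform of \<open>h\<close> exceeds 1/16 in modulus, the transform
      of \<open>1 - k\<close> is 0.\<close>
    show "norm ((1 - k) * h * (1 - k)) \<le> 1/16"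
    proof (rule norm_le_gelfand)
      fix s assume s: "s \<in> maximal_ideals D"
      define t where "t = Re (gelfand h s)"
      have "gelfand ((1 - k) * h * (1 - k)) s = of_real ((1 - \<kappa> t) * t * (1 - \<kappa> t))"
        using k h s real[OF s] by (simp add: gelfand_diff gelfand_mult gelfand_one t_def)
      then have eq: "cmod (gelfand ((1 - k) * h * (1 - k)) s) = \<bar>(1 - \<kappa> t) * t * (1 - \<kappa> t)\<bar>"
        by (metis norm_of_real)
      show "cmod (gelfand ((1 - k) * h * (1 - k)) s) \<le> 1/16"
      proof (cases "\<bar>t\<bar> \<le> 1/16")
        case True
        have b: "0 \<le> 1 - \<kappa> t" "1 - \<kappa> t \<le> 1" by (auto simp: \<kappa>_def)
        have "(1 - \<kappa> t) * \<bar>t\<bar> \<le> 1 * (1/16)" using True b by (intro mult_mono) auto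
        then have "((1 - \<kappa> t) * \<bar>t\<bar>) * (1 - \<kappa> t) \<le> 1/16 * 1" using b by (intro mult_mono) auto
        then show ?thesis unfolding eq using b by (simp add: abs_mult)
      next
        case False
        then have "\<kappa> t = 1" by (auto simp: \<kappa>_def)
        then show ?thesis unfolding eq by simp
      qed
    qed (use k h sa in \<open>auto simp: star_mult star_diff mult.assoc\<close>)
  qed
qed

section \<open>Unimodular tuples\<close>

lemma Lg_iff: "a \<in> Lg n \<longleftrightarrow> (\<exists>b. (\<Sum>i<n. b i * a i) = 1)"
proof
  assume "a \<in> Lg n"
  then have "1 \<in> {(\<Sum>i<n. b i * a i) |b. True}" by (simp add: Lg_def)
  then show "\<exists>b. (\<Sum>i<n. b i * a i) = 1" by force
next
  assume "\<exists>b. (\<Sum>i<n. b i * a i) = 1"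
  then obtain b where b: "(\<Sum>i<n. b i * a i) = 1" ..
  have "\<exists>b. x = (\<Sum>i<n. b i * a i)" for x
    using b by (intro exI[of _ "\<lambda>i. x * b i"]) (simp add: mult.assoc flip: sum_distrib_left)
  then show "a \<in> Lg n" unfolding Lg_def by blast
qed

lemma LgI: "(\<Sum>i<n. b i * a i) = 1 \<Longrightarrow> a \<in> Lg n"
  unfolding Lg_iff by (rule exI[of _ b])

lemma Lg_cong: "(\<And>i. i < n \<Longrightarrow> a i = a' i) \<Longrightarrow> a \<in> Lg n \<longleftrightarrow> a' \<in> Lg n"
  by (simp add: Lg_iff)

lemma Lg_mult_right:
  assumes "a \<in> Lg n" "u' * u = 1"
  shows "(\<lambda>i. a i * u) \<in> Lg n"
proof -
  obtain d where d: "(\<Sum>i<n. d i * a i) = 1" using assms(1) by (auto simp: Lg_iff)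
  have "(\<Sum>i<n. (u' * d i) * (a i * u)) = u' * (\<Sum>i<n. d i * a i) * u"
    by (simp add: sum_distrib_left sum_distrib_right mult.assoc)
  then show ?thesis using d assms(2) by (auto simp: Lg_iff)
qed

text \<open>Modulo the left ideal generated by \<open>\<alpha>\<close>, the perturbed tuple is the image of \<open>a\<close> under the
  rank-one perturbation \<open>1 + (\<delta>\<^sub>i b\<^sub>j)\<close> of the identity matrix, which is invertible as soon as
  \<open>1 + \<Sum> b\<^sub>i \<delta>\<^sub>i\<close> is.\<close>

lemma Lg_rank_one_perturbation:
  fixes a b \<delta> e :: "nat \<Rightarrow> 'a::ring_1"
  assumes w: "(1 + (\<Sum>i<n. b i * \<delta> i)) * w = 1"
    and v: "(\<lambda>i. a i + \<delta> i * (\<Sum>j<n. b j * a j) + e i * \<alpha>) \<in> Lg n"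
  shows "\<exists>x. (\<lambda>i. a i + x i * \<alpha>) \<in> Lg n"
proof -
  define \<beta> where "\<beta> = (\<Sum>j<n. b j * a j)"
  obtain d where d: "(\<Sum>i<n. d i * (a i + \<delta> i * \<beta> + e i * \<alpha>)) = 1"
    using v by (auto simp: Lg_iff \<beta>_def)
  define S where "S = (\<Sum>i<n. b i * e i)"
  define P where "P = (\<Sum>i<n. b i * \<delta> i)"
  \<comment> \<open>The choice is dictated by \<open>a i + x i * \<alpha> + \<delta> i * T = a i +
    \<delta> i * \<beta> + e i * \<alpha>\<close>, where \<open>T\<close> is to be the combination
    of the new tuple with coefficients \<open>b\<close>.\<close>
  define x where "x i = e i - \<delta> i * w * S" for i
  define T where "T = \<beta> + w * S * \<alpha>"
  have Pw: "P * w = 1 - w" using w by (simp add: P_def algebra_simps)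
  have "(\<Sum>i<n. b i * (a i + x i * \<alpha>)) = \<beta> + S * \<alpha> - P * w * S * \<alpha>"
    by (simp add: x_def \<beta>_def S_def P_def sum.distrib sum_subtractf sum_distrib_right algebra_simps)
  also have "\<dots> = T" unfolding Pw T_def by (simp add: algebra_simps)
  finally have T: "(\<Sum>i<n. b i * (a i + x i * \<alpha>)) = T" .
  \<comment> \<open>The new coefficients are the row \<open>d\<close> multiplied by the matrix that
    is the identity plus the entries \<open>\<delta> i * b j\<close>.\<close>
  have "(\<Sum>i<n. (d i + (\<Sum>j<n. d j * \<delta> j) * b i) * (a i + x i * \<alpha>)) =
      (\<Sum>i<n. d i * (a i + x i * \<alpha>)) + (\<Sum>j<n. d j * \<delta> j) * (\<Sum>i<n. b i * (a i + x i * \<alpha>))"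
    by (simp add: distrib_right sum.distrib sum_distrib_left mult.assoc)
  also have "\<dots> = (\<Sum>i<n. d i * (a i + x i * \<alpha> + \<delta> i * T))"
    unfolding T by (simp add: sum_distrib_right distrib_left sum.distrib mult.assoc)
  also have "\<dots> = (\<Sum>i<n. d i * (a i + \<delta> i * \<beta> + e i * \<alpha>))"
    by (simp add: x_def T_def algebra_simps)
  also note d
  finally have "(\<lambda>i. a i + x i * \<alpha>) \<in> Lg n" by (rule LgI)
  then show ?thesis by (rule exI[of _ x])
qed

lemma inverse_near_one:
  fixes u :: "'b::{real_normed_algebra_1, banach}"
  assumes "norm (u - 1) < 1"
  obtains v where "u * v = 1" "v * u = 1"
  using neumann[of UNIV "1 - u"] assms by (auto simp: norm_minus_commute)

lemma Lg_near:
  fixes a b :: "nat \<Rightarrow> 'b::{real_normed_algebra_1, banach}"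
  assumes "norm ((\<Sum>i<n. b i * a i) - 1) < 1"
  shows "a \<in> Lg n"
proof -
  obtain v where "v * (\<Sum>i<n. b i * a i) = 1" using inverse_near_one[OF assms] by blast
  then have "(\<Sum>i<n. (v * b i) * a i) = 1" by (simp add: sum_distrib_left mult.assoc)
  then show ?thesis by (rule LgI)
qed

lemma norm_sum_mult_le:
  fixes b d :: "nat \<Rightarrow> 'b::real_normed_algebra"
  assumes "\<And>i. i < n \<Longrightarrow> norm (d i) \<le> \<eta>"
  shows "norm (\<Sum>i<n. b i * d i) \<le> (\<Sum>i<n. norm (b i)) * \<eta>"
    and "norm (\<Sum>i<n. d i * b i) \<le> (\<Sum>i<n. norm (b i)) * \<eta>"
proof -
  have "norm (\<Sum>i<n. b i * d i) \<le> (\<Sum>i<n. norm (b i) * \<eta>)"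
    using assms by (intro sum_norm_le order_trans[OF norm_mult_ineq] mult_left_mono) auto
  then show "norm (\<Sum>i<n. b i * d i) \<le> (\<Sum>i<n. norm (b i)) * \<eta>" by (simp add: sum_distrib_right)
  have "norm (\<Sum>i<n. d i * b i) \<le> (\<Sum>i<n. \<eta> * norm (b i))"
    using assms by (intro sum_norm_le order_trans[OF norm_mult_ineq] mult_right_mono) auto
  then show "norm (\<Sum>i<n. d i * b i) \<le> (\<Sum>i<n. norm (b i)) * \<eta>"
    by (simp add: sum_distrib_left[symmetric] mult.commute)
qed

section \<open>Dense full morphisms and the stable rank\<close>

locale dense_full_morphism =
  fixes f :: "'a::star_algebra_1 \<Rightarrow> 'b::cstar_algebra_1"
  assumes morphism: "star_morphism f" and dense: "dense_morphism f" and full: "full_morphism f"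
begin

lemma f_simps [simp]:
  "f (x + y) = f x + f y" "f (x * y) = f x * f y" "f 1 = 1" "f (star x) = star (f x)"
  using morphism by (auto simp: star_morphism_def)

lemma f_zero [simp]: "f 0 = 0"
  using f_simps(1)[of 0 0] by simp

lemma f_sum: "f (\<Sum>i<n. g i) = (\<Sum>i<(n::nat). f (g i))"
  by (induction n) auto

lemma approx:
  assumes "e > 0" shows "\<exists>x. norm (f x - z) < e"
proof -
  have "z \<in> closure (range f)" using dense by (simp add: dense_morphism_def)
  then show ?thesis using assms by (auto simp: closure_approachable dist_norm)
qed

lemma approx_family:
  assumes "e > 0" shows "\<exists>c. \<forall>i. norm (f (c i) - b i) < e"
  using approx[OF assms] by (intro choice allI)

text \<open>For the reflecting direction the coefficients are approximated from the range of
  \<open>f\<close>. The combination then has an image close to 1, hence invertible, and fullness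
  makes it invertible in the domain.\<close>

lemma Lg_image_iff: "(\<lambda>i. f (a i)) \<in> Lg n \<longleftrightarrow> a \<in> Lg n"
proof
  assume "a \<in> Lg n"
  then obtain b where "(\<Sum>i<n. b i * a i) = 1" by (auto simp: Lg_iff)
  then have "(\<Sum>i<n. f (b i) * f (a i)) = 1" by (metis (no_types, lifting) f_simps(2,3) f_sum sum.cong)
  then show "(\<lambda>i. f (a i)) \<in> Lg n" by (rule LgI)
next
  assume "(\<lambda>i. f (a i)) \<in> Lg n"
  then obtain b where b: "(\<Sum>i<n. b i * f (a i)) = 1" by (auto simp: Lg_iff)
  define s where "s = (\<Sum>i<n. norm (f (a i)))"
  have s: "s \<ge> 0" by (simp add: s_def sum_nonneg)
  obtain c where c: "\<And>i. norm (f (c i) - b i) < 1 / (1 + s)"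
    using approx_family[of "1 / (1 + s)" b] s by auto
  have "f (\<Sum>i<n. c i * a i) - 1 = (\<Sum>i<n. (f (c i) - b i) * f (a i))"
    unfolding f_sum b[symmetric] by (simp add: left_diff_distrib sum_subtractf)
  also have "norm \<dots> \<le> s * (1 / (1 + s))"
    unfolding s_def by (rule norm_sum_mult_le(2)) (use c s in \<open>auto simp: s_def intro: less_imp_le\<close>)
  also have "\<dots> < 1" using s by (simp add: field_simps)
  finally obtain v where "f (\<Sum>i<n. c i * a i) * v = 1" "v * f (\<Sum>i<n. c i * a i) = 1"
    by (rule inverse_near_one)
  then have "invertible_elem (f (\<Sum>i<n. c i * a i))" by (auto simp: invertible_elem_def)
  then have "invertible_elem (\<Sum>i<n. c i * a i)" using full by (simp add: full_morphism_def)
  then obtain v where "v * (\<Sum>i<n. c i * a i) = 1" by (auto simp: invertible_elem_def)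
  then have "(\<Sum>i<n. (v * c i) * a i) = 1" by (simp add: sum_distrib_left mult.assoc)
  then show "a \<in> Lg n" by (rule LgI)
qed

text \<open>The reduced tuple stays unimodular when the coefficients \<open>c\<close> are replaced
  by nearby elements of the range, and \<open>Lg_image_iff\<close> brings it back.\<close>

lemma Bsr_condition_domain:
  assumes "Bsr_condition TYPE('b) n"
  shows "Bsr_condition TYPE('a) n"
  unfolding Bsr_condition_def
proof (intro allI impI)
  fix a :: "nat \<Rightarrow> 'a" assume "a \<in> Lg (n + 1)"
  then have "(\<lambda>i. f (a i)) \<in> Lg (n + 1)" by (simp only: Lg_image_iff)
  then obtain c where "(\<lambda>i. f (a i) + c i * f (a n)) \<in> Lg n"
    using assms unfolding Bsr_condition_def by blast
  then obtain d where d: "(\<Sum>i<n. d i * (f (a i) + c i * f (a n))) = 1" by (auto simp: Lg_iff)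
  define s where "s = (\<Sum>i<n. norm (d i))"
  have s: "s \<ge> 0" by (simp add: s_def sum_nonneg)
  define r where "r = norm (f (a n))"
  have r: "r \<ge> 0" by (simp add: r_def)
  \<comment> \<open>This gives \<open>s * (\<eta> * r) < 1\<close>; the added ones cover
    \<open>s = 0\<close> and \<open>r = 0\<close>.\<close>
  define \<eta> where "\<eta> = 1 / ((1 + s) * (1 + r))"
  have "\<eta> > 0" using s r by (simp add: \<eta>_def)
  then obtain c' where c': "\<And>i. norm (f (c' i) - c i) < \<eta>" using approx_family[of \<eta> c] by blast
  have "(\<Sum>i<n. d i * f (a i + c' i * a n)) - 1 = (\<Sum>i<n. d i * ((f (c' i) - c i) * f (a n)))"
    unfolding d[symmetric] by (simp add: algebra_simps sum_subtractf sum.distrib)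
  also have "norm \<dots> \<le> s * (\<eta> * r)"
    unfolding s_def r_def
  proof (intro norm_sum_mult_le order_trans[OF norm_mult_ineq] mult_right_mono)
    show "norm (f (c' i) - c i) \<le> \<eta>" for i using c'[of i] by simp
  qed simp
  also have "\<dots> = (s / (1 + s)) * (r / (1 + r))" by (simp add: \<eta>_def)
  also have "\<dots> < 1 * 1" using s r by (intro mult_strict_mono') (auto simp: field_simps)
  finally have "(\<lambda>i. f (a i + c' i * a n)) \<in> Lg n" by (intro Lg_near[where b = d]) simp
  then have "(\<lambda>i. a i + c' i * a n) \<in> Lg n" by (simp only: Lg_image_iff)
  then show "\<exists>c. (\<lambda>i. a i + c i * a n) \<in> Lg n" by (rule exI[of _ c'])
qed

lemma Bsr_condition_codomain:
  assumes normal: "locally_normal (range f)" and cond: "Bsr_condition TYPE('a) n"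
  shows "Bsr_condition TYPE('b) n"
  unfolding Bsr_condition_def
proof (intro allI impI)
  fix a :: "nat \<Rightarrow> 'b" assume "a \<in> Lg (n + 1)"
  then obtain b where b: "(\<Sum>i<n+1. b i * a i) = 1" by (auto simp: Lg_iff)
  \<comment> \<open>Multiples of \<alpha> are multiples of \<open>a n\<close>, so it suffices to
    reduce with \<alpha>; the factor \<open>b n\<close> joins the coefficients at the end.\<close>
  define \<alpha> where "\<alpha> = b n * a n"
  have b1: "(\<Sum>i<n. b i * a i) = 1 - \<alpha>" using b by (simp add: \<alpha>_def eq_diff_eq)
  define s where "s = (\<Sum>i<n. norm (b i))"
  define t where "t = (\<Sum>i<n. norm (a i))"
  have s: "s \<ge> 0" and t: "t \<ge> 0" by (simp_all add: s_def t_def sum_nonneg)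
  \<comment> \<open>The permitted distance of \<open>u\<close> from 1: small enough to invert
    \<open>u\<close>, and to keep the errors \<open>a i * (u - 1)\<close> small after weighting by
    the \<open>b i\<close>.\<close>
  define \<tau> where "\<tau> = 1 / ((1 + s) * (1 + t)) / 4"
  \<comment> \<open>The permitted approximation error: 128 combines the bound 64 on
    \<open>norm g\<close> with the factor 2 in the bound on \<open>norm (h - h')\<close>, so that
    \<open>norm (u - 1) \<le> \<tau>\<close>.\<close>
  define \<eta> where "\<eta> = \<tau> / (128 * (1 + norm \<alpha>))"
  have \<tau>0: "\<tau> > 0" using s t by (simp add: \<tau>_def)
  then have \<eta>0: "\<eta> > 0" by (simp add: \<eta>_def add_pos_nonneg)
  define r where "r = (1 + s) * (1 + t)"
  have \<tau>r: "\<tau> = 1 / r / 4" by (simp only: \<tau>_def r_def)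
  have r: "r = 1 + s + t + s * t" "s * t \<ge> 0" using s t by (simp_all add: r_def algebra_simps)
  then have "r > 0" using s t by linarith
  moreover have "s \<le> r" "s * t \<le> r" "1 \<le> r" unfolding r(1) using r(2) s t by linarith+
  ultimately have "s / r \<le> 1" "s * t / r \<le> 1" "1 / r \<le> 1" by (simp_all only: divide_le_eq_1_pos)
  then have \<tau>: "s * \<tau> \<le> 1/4" "s * (t * \<tau>) \<le> 1/4" "\<tau> \<le> 1/4"
    by (simp_all add: \<tau>r)
  have \<eta>1: "\<eta> * (128 * (1 + norm \<alpha>)) = \<tau>"
    by (simp add: \<eta>_def add_nonneg_eq_0_iff)
  have \<eta>: "128 * \<eta> \<le> \<tau>"
    unfolding \<eta>1[symmetric] using \<eta>0 by (simp add: distrib_left)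
  have s\<eta>: "s * \<eta> \<le> 1/512"
    using mult_left_mono[OF \<eta> s] \<tau>(1) by simp
  obtain A where A: "\<And>i. norm (f (A i) - a i) < \<eta>" using approx_family[OF \<eta>0, of a] by blast
  obtain A' where A': "norm (f A' - \<alpha>) < \<eta>" using approx[OF \<eta>0] by blast
  define \<alpha>' where "\<alpha>' = f A'"
  define h h' where "h = star \<alpha> * \<alpha>" and "h' = star \<alpha>' * \<alpha>'"
  have "h' = f (star A' * A')" by (simp add: h'_def \<alpha>'_def)
  then have "h' \<in> range f" by blast
  moreover have "star h' = h'" by (simp add: h'_def star_mult star_star)
  ultimately obtain y g k where y: "y \<in> range f" and ygh: "y * g * h' = y" and g: "norm g \<le> 64"
    and ky: "k * y = k" and k: "star k = k" "norm ((1 - k) * h' * (1 - k)) \<le> 1/16"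
    using separating_elements[OF normal] by metis
  obtain Y where Y: "y = f Y" using y by blast

  \<comment> \<open>By the C*-identity this square is the norm of
    \<open>(1 - k) * h' * (1 - k)\<close>.\<close>
  have "(norm (\<alpha>' * (1 - k)))\<^sup>2 \<le> 1/16"
    using k by (simp add: cstar_identity[symmetric] star_mult star_diff h'_def mult.assoc)
  also have "1/16 = (1/4 :: real)\<^sup>2" by (simp add: power2_eq_square)
  finally have \<alpha>k: "norm (\<alpha>' * (1 - k)) \<le> 1/4" by (rule power2_le_imp_le) simp

  \<comment> \<open>Index \<open>n\<close> falls in the second case, so \<open>Y\<close> is the last
    entry, with which the others are reduced.\<close>
  define p where "p i = (if i < n then A i else Y)" for i
  have "(\<lambda>i. f (p i)) \<in> Lg (n + 1)"
  proof (rule Lg_near)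
    \<comment> \<open>The coefficient \<open>\<alpha>' * k\<close> uses \<open>k * y = k\<close>:
      its product with \<open>y\<close> is \<open>\<alpha>' * k\<close>, which differs from
      \<alpha>' only by the small \<open>\<alpha>' * (1 - k)\<close>.\<close>
    have "(\<Sum>i<n+1. (if i < n then b i else \<alpha>' * k) * f (p i)) - 1 =
        (\<Sum>i<n. b i * f (A i)) + \<alpha>' * k - 1"
      using ky by (simp add: p_def Y mult.assoc)
    also have "\<dots> = (\<Sum>i<n. b i * (f (A i) - a i)) + (\<alpha>' - \<alpha>) - \<alpha>' * (1 - k)"
      using b1 by (simp add: right_diff_distrib sum_subtractf)
    also have "norm \<dots> \<le> s * \<eta> + \<eta> + 1/4"
    proof -
      have "norm (\<Sum>i<n. b i * (f (A i) - a i)) \<le> s * \<eta>"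
        unfolding s_def using A by (intro norm_sum_mult_le(1)) (simp add: less_imp_le)
      moreover have "norm (\<alpha>' - \<alpha>) \<le> \<eta>" using A' by (simp add: \<alpha>'_def)
      ultimately show ?thesis
        using \<alpha>k by (rule order_trans[OF norm_triangle_ineq4 add_mono[OF norm_triangle_mono]])
    qed
    also have "\<dots> < 1" using s\<eta> \<eta> \<tau>(3) by linarith
    finally show "norm ((\<Sum>i<n+1. (if i < n then b i else \<alpha>' * k) * f (p i)) - 1) < 1" .
  qed
  then have "p \<in> Lg (n + 1)" by (simp only: Lg_image_iff)
  then obtain c where "(\<lambda>i. p i + c i * p n) \<in> Lg n"
    using cond unfolding Bsr_condition_def by blast
  then have "(\<lambda>i. f (p i + c i * p n)) \<in> Lg n" by (simp only: Lg_image_iff)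
  then have unimod: "(\<lambda>i. f (A i) + f (c i) * y) \<in> Lg n"
    by (rule Lg_cong[THEN iffD1, rotated]) (simp add: p_def Y)

  \<comment> \<open>Because \<open>y * g * h' = y\<close>, multiplication by \<open>u\<close>
    replaces \<open>y\<close> by \<open>y * g * h\<close>, a left multiple of \<alpha>.\<close>
  define u where "u = 1 + g * (h - h')"
  have "h - h' = star \<alpha> * (\<alpha> - \<alpha>') + star (\<alpha> - \<alpha>') * \<alpha>'"
    by (simp add: h_def h'_def star_diff algebra_simps)
  also have "norm \<dots> \<le> norm \<alpha> * \<eta> + \<eta> * (norm \<alpha> + \<eta>)"
  proof -
    have d: "norm (\<alpha> - \<alpha>') \<le> \<eta>" using A' by (simp add: \<alpha>'_def norm_minus_commute)
    have "norm \<alpha>' \<le> norm \<alpha> + norm (\<alpha>' - \<alpha>)" using norm_triangle_sub by blast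
    then have "norm \<alpha>' \<le> norm \<alpha> + \<eta>" using d by (simp add: norm_minus_commute)
    then show ?thesis using d \<eta>0
      by (intro order_trans[OF norm_triangle_ineq] add_mono order_trans[OF norm_mult_ineq] mult_mono) auto
  qed
  also have "\<dots> \<le> \<eta> * (2 * (1 + norm \<alpha>))"
    using \<eta> \<tau>(3) \<eta>0 mult_left_mono[of \<eta> 2 \<eta>] by (simp add: algebra_simps)
  finally have hh: "norm (h - h') \<le> \<eta> * (2 * (1 + norm \<alpha>))" .
  have "norm (u - 1) \<le> norm g * norm (h - h')" by (simp add: u_def norm_mult_ineq)
  also have "\<dots> \<le> 64 * (\<eta> * (2 * (1 + norm \<alpha>)))" using g hh by (intro mult_mono) auto
  also have "\<dots> = \<tau>" unfolding \<eta>1[symmetric] by simp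
  finally have u: "norm (u - 1) \<le> \<tau>" .
  obtain u' where "u' * u = 1"
    by (rule inverse_near_one[of u]) (use u \<tau>(3) in linarith)
  then have "(\<lambda>i. (f (A i) + f (c i) * y) * u) \<in> Lg n" using unimod Lg_mult_right by blast
  moreover have yu: "y * u = y * g * star \<alpha> * \<alpha>"
    using ygh by (simp add: u_def h_def algebra_simps)
  define \<delta> where "\<delta> i = f (A i) * u - a i" for i
  \<comment> \<open>The extra summand \<open>\<delta> i\<close> compensates for writing the error as
    \<open>\<delta> i * (1 - \<alpha>)\<close>, where \<open>1 - \<alpha>\<close> is the combination
    of the \<open>a j\<close> with coefficients \<open>b j\<close>.\<close>
  define e where "e i = \<delta> i + f (c i) * (y * g * star \<alpha>)" for i
  have "(f (A i) + f (c i) * y) * u = a i + \<delta> i * (\<Sum>j<n. b j * a j) + e i * \<alpha>" for i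
  proof -
    have "(f (A i) + f (c i) * y) * u = f (A i) * u + f (c i) * (y * u)"
      by (simp add: distrib_right mult.assoc)
    also have "\<dots> = a i + \<delta> i * (1 - \<alpha>) + e i * \<alpha>"
      unfolding yu e_def by (simp add: \<delta>_def algebra_simps)
    finally show ?thesis using b1 by simp
  qed
  ultimately have pert: "(\<lambda>i. a i + \<delta> i * (\<Sum>j<n. b j * a j) + e i * \<alpha>) \<in> Lg n" by simp
  have "norm (\<delta> i) \<le> 2 * \<eta> + t * \<tau>" if "i < n" for i
  proof -
    have "\<delta> i = (f (A i) - a i) * u + a i * (u - 1)" by (simp add: \<delta>_def algebra_simps)
    also have "norm \<dots> \<le> \<eta> * 2 + t * \<tau>"
    proof (intro order_trans[OF norm_triangle_ineq] add_mono order_trans[OF norm_mult_ineq] mult_mono)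
      show "norm (f (A i) - a i) \<le> \<eta>" using A[of i] by simp
      show "norm u \<le> 2" using norm_triangle_sub[of u 1] u \<tau>(3) by simp
      show "norm (a i) \<le> t" unfolding t_def using that by (intro member_le_sum) auto
    qed (use u \<eta>0 t in auto)
    finally show ?thesis by simp
  qed
  then have "norm (\<Sum>i<n. b i * \<delta> i) \<le> s * (2 * \<eta> + t * \<tau>)"
    unfolding s_def by (rule norm_sum_mult_le(1))
  also have "\<dots> < 1" using s\<eta> \<tau>(2) by (simp add: distrib_left)
  finally have "norm ((1 + (\<Sum>i<n. b i * \<delta> i)) - 1) < 1" by simp
  then obtain w where "(1 + (\<Sum>i<n. b i * \<delta> i)) * w = 1" by (rule inverse_near_one)
  from Lg_rank_one_perturbation[OF this pert]
  obtain x where "(\<lambda>i. a i + x i * \<alpha>) \<in> Lg n" by blast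
  then have "(\<lambda>i. a i + (x i * b n) * a n) \<in> Lg n" by (simp add: \<alpha>_def mult.assoc)
  then show "\<exists>c. (\<lambda>i. a i + c i * a n) \<in> Lg n" by (rule exI[of _ "\<lambda>i. x i * b n"])
qed

end

theorem theorem4p9:
  fixes f :: "'a::{frechet_algebra_1, star_algebra_1} \<Rightarrow> 'b::cstar_algebra_1"
  assumes "Q_algebra TYPE('a)"
    and "star_morphism f"
    and "dense_morphism f"
    and "full_morphism f"
    and "locally_normal (range f)"
  shows "Bsr TYPE('a) = Bsr TYPE('b)"
proof -
  interpret dense_full_morphism f using assms by unfold_locales
  have "Bsr_condition TYPE('a) n \<longleftrightarrow> Bsr_condition TYPE('b) n" for n
    using Bsr_condition_domain Bsr_condition_codomain assms(5) by blast
  then show ?thesis by (simp add: Bsr_def)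
qed

end
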